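(* For every dimension $d\ge 1$ there exist constants $0<c<C<\infty$ (depending only on $d$) such that for all $\beta\ge2$ $$\frac{c}{\log(\beta)}\le\theta(\beta)\le\frac{C}{\log(\beta)}.$$
   Context: Model: fix $d\ge1$; $\|\cdot\|$ is the Euclidean norm, $\|\cdot\|_\infty$ the maximum norm, $\mathcal C=[0,1)^d$, $\mathbf 0$ the zero vector. For $\beta\ge0$, $\mathbb P_\beta$ (expectation $\mathbb E_\beta$) is the law of the random graph with vertex set $\mathbb Z^d$ in which edges $\{u,v\}$, $u\ne v$, are open independently of each other, with probability $1$ if $\|u-v\|_\infty=1$ and with probability $p(\beta,\{u,v\})=1-\exp\left(-\beta\int_{u+\mathcal C}\int_{v+\mathcal C}\frac{1}{\|x-y\|^{2d}}\,dx\,dy\right)$ if $\|u-v\|_\infty\ge2$. $D(u,v)$ is the graph distance along open edges, and $D_A(u,v)$ the graph distance using only open edges with both endpoints in $A$. Distance exponent: with $V_{\mathbf 0}^n=\{0,\ldots,n-1\}^d$ and $\Lambda(n,\beta)=\max_{u,v\in V_{\mathbf 0}^n}\mathbb E_\beta[D_{V_{\mathbf 0}^n}(u,v)]+1$, the exponent $\theta(\beta)=\theta(d,\beta)$ is $\theta(\beta)=\lim_{n\to\infty}\frac{\log\Lambda(n,\beta)}{\log n}=\inf_{n\ge2}\frac{\log\Lambda(n,\beta)}{\log n}$. For $\beta>0$ it is the unique exponent in $(0,1)$ such that for every $\varepsilon>0$ there are $0<c'<C'<\infty$ with $\mathbb P_\beta(c'\|u\|^{\theta}\le D(\mathbf 0,u)\le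 C'\|u\|^{\theta})>1-\varepsilon$ for all $u\in\mathbb Z^d$. *)

theory Defs
  imports "HOL-Probability.Probability"
begin

definition lattice_point :: "int ^ 'd \<Rightarrow> real ^ 'd" where
  "lattice_point u = (\<chi> i. real_of_int (u $ i))"

definition cell :: "int ^ 'd \<Rightarrow> (real ^ 'd) set" where
  "cell u = (+) (lattice_point u) ` {x. \<forall>i. 0 \<le> x $ i \<and> x $ i < 1}"

definition edges :: "(int ^ 'd) set set" where
  "edges = {{u, v} | u v. u \<noteq> v}"

text \<open>Only meaningful for \<open>u \<noteq> v\<close>; on distinct lattice points the maximum norm is a positive
  integer, so the second branch is the case of maximum norm at least 2.\<close>

definition pair_prob :: "real \<Rightarrow> int ^ 'd::finite \<Rightarrow> int ^ 'd \<Rightarrow> real" where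
  "pair_prob \<beta> u v =
    (if infnorm (lattice_point u - lattice_point v) = 1 then 1
     else 1 - exp (- \<beta> * (LINT x:cell u|lborel. LINT y:cell v|lborel.
                              1 / norm (x - y) ^ (2 * CARD('d)))))"

text \<open>The description is well defined on \<open>edges\<close>: see \<open>edge_prob_eq\<close> below.\<close>

definition edge_prob :: "real \<Rightarrow> (int ^ 'd::finite) set \<Rightarrow> real" where
  "edge_prob \<beta> e = (THE p. \<exists>u v. e = {u, v} \<and> p = pair_prob \<beta> u v)"

text \<open>A configuration \<open>\<omega>\<close> maps each edge to \<open>True\<close> iff the edge is open.\<close>

definition percolation :: "real \<Rightarrow> ((int ^ 'd::finite) set \<Rightarrow> bool) measure" where
  "percolation \<beta> = (\<Pi>\<^sub>M e\<in>edges. measure_pmf (bernoulli_pmf (edge_prob \<beta> e)))"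

definition open_step ::
  "((int ^ 'd) set \<Rightarrow> bool) \<Rightarrow> (int ^ 'd) set \<Rightarrow> ((int ^ 'd) \<times> (int ^ 'd)) set" where
  "open_step \<omega> A = {(u, v). u \<in> A \<and> v \<in> A \<and> {u, v} \<in> edges \<and> \<omega> {u, v}}"

text \<open>Graph distance inside \<open>A\<close>: the least number of steps of an open walk in \<open>A\<close>,
  and \<open>\<infinity>\<close> if there is none.\<close>

definition graph_dist ::
  "((int ^ 'd) set \<Rightarrow> bool) \<Rightarrow> (int ^ 'd) set \<Rightarrow> int ^ 'd \<Rightarrow> int ^ 'd \<Rightarrow> enat" where
  "graph_dist \<omega> A u v = Inf {enat k | k. (u, v) \<in> open_step \<omega> A ^^ k}"

definition lattice_box :: "nat \<Rightarrow> (int ^ 'd) set" where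
  "lattice_box n = {u. \<forall>i. 0 \<le> u $ i \<and> u $ i < int n}"

text \<open>The expectation is taken in \<open>[0, \<infinity>]\<close>. For points of \<open>lattice_box n\<close> it is finite because
  nearest-neighbour edges are almost surely open, so \<open>enn2real\<close> loses nothing there.\<close>

definition expected_dist ::
  "real \<Rightarrow> (int ^ 'd::finite) set \<Rightarrow> int ^ 'd \<Rightarrow> int ^ 'd \<Rightarrow> real" where
  "expected_dist \<beta> A u v =
    enn2real (\<integral>\<^sup>+ \<omega>. ennreal_of_enat (graph_dist \<omega> A u v) \<partial>percolation \<beta>)"

text \<open>Intended for \<open>n \<ge> 1\<close>; for \<open>n = 0\<close> the maximum is over the empty set. The dimension
  enters through the type argument.\<close>

definition Lambda :: "'d::finite itself \<Rightarrow> nat \<Rightarrow> real \<Rightarrow> real" where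
  "Lambda _ n \<beta> =
    Max {expected_dist \<beta> (lattice_box n) u v | u v :: int ^ 'd. u \<in> lattice_box n \<and> v \<in> lattice_box n} + 1"

text \<open>The limit exists, and equals the infimum over \<open>n \<ge> 2\<close>, because \<open>Lambda\<close> is
  submultiplicative in \<open>n\<close>; this is not proved here.\<close>

definition distance_exponent :: "'d::finite itself \<Rightarrow> real \<Rightarrow> real" where
  "distance_exponent d \<beta> = lim (\<lambda>n. ln (Lambda d n \<beta>) / ln (real n))"

lemma cell_iff:
  fixes x :: "real ^ 'a::finite"
  shows "x \<in> cell u \<longleftrightarrow> (\<forall>i. real_of_int (u $ i) \<le> x $ i \<and> x $ i < real_of_int (u $ i) + 1)"
proof -
  have *: "x = y + z \<longleftrightarrow> z = x - y" for y z :: "real ^ 'a"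
    by (metis add_diff_cancel_left' add.commute diff_add_cancel)
  have "x \<in> cell u \<longleftrightarrow> x - lattice_point u \<in> {x. \<forall>i. 0 \<le> x $ i \<and> x $ i < 1}"
    unfolding cell_def image_iff Bex_def * by simp
  then show ?thesis
    by (simp add: lattice_point_def algebra_simps)
qed

lemma cell_measurable [measurable]: "cell (u :: int ^ 'd::finite) \<in> sets borel"
proof -
  have "cell u = {x. \<forall>i. real_of_int (u $ i) \<le> x $ i \<and> x $ i < real_of_int (u $ i) + 1}"
    using cell_iff by blast
  also have "\<dots> \<in> sets borel"
    by measurable
  finally show ?thesis .
qed

lemma emeasure_cell_finite: "emeasure lborel (cell (u :: int ^ 'd::finite)) < \<infinity>"
proof -
  have "cell u \<subseteq> cbox (lattice_point u) (lattice_point u + 1)"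
    by (auto simp: cell_iff mem_box_cart lattice_point_def less_imp_le)
  then have "bounded (cell u)"
    using bounded_cbox bounded_subset by blast
  then show ?thesis
    using emeasure_bounded_finite by blast
qed

lemma infnorm_lattice_cases:
  fixes u v :: "int ^ 'd::finite"
  assumes "u \<noteq> v" and "infnorm (lattice_point u - lattice_point v) \<noteq> 1"
  obtains i where "\<bar>u $ i - v $ i\<bar> \<ge> 2"
proof (rule ccontr)
  assume *: "\<not> thesis"
  have le: "\<bar>u $ i - v $ i\<bar> \<le> 1" for i
    using that[of i] * by linarith
  obtain j where "u $ j \<noteq> v $ j"
    using assms(1) by (auto simp: vec_eq_iff)
  then have j: "\<bar>u $ j - v $ j\<bar> = 1"
    using le[of j] by linarith
  have "\<bar>(lattice_point u - lattice_point v) $ i\<bar> = real_of_int \<bar>u $ i - v $ i\<bar>" for i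
    by (simp add: lattice_point_def)
  then have "infnorm (lattice_point u - lattice_point v)
      = Sup {real_of_int \<bar>u $ i - v $ i\<bar> | i. i \<in> UNIV}"
    by (simp add: infnorm_cart)
  also have "\<dots> = 1"
  proof (rule cSup_eq_maximum)
    show "1 \<in> {real_of_int \<bar>u $ i - v $ i\<bar> | i. i \<in> UNIV}"
      using j by (metis (mono_tags, lifting) UNIV_I mem_Collect_eq of_int_1)
    show "x \<le> 1" if "x \<in> {real_of_int \<bar>u $ i - v $ i\<bar> | i. i \<in> UNIV}" for x
    proof -
      obtain i where "x = real_of_int \<bar>u $ i - v $ i\<bar>"
        using \<open>x \<in> _\<close> by blast
      then show ?thesis
        using le[of i] by linarith
    qed
  qed
  finally show False
    using assms(2) by simp
qed

lemma pair_prob_commute: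
  fixes u v :: "int ^ 'd::finite"
  assumes "u \<noteq> v"
  shows "pair_prob \<beta> u v = pair_prob \<beta> v u"
proof (cases "infnorm (lattice_point u - lattice_point v) = 1")
  case True
  then show ?thesis
    by (simp add: pair_prob_def infnorm_sub)
next
  case False
  then obtain i where i: "\<bar>u $ i - v $ i\<bar> \<ge> 2"
    using infnorm_lattice_cases assms by blast
  define f :: "real ^ 'd \<Rightarrow> real ^ 'd \<Rightarrow> real" where
    "f x y = indicator (cell u) x * (indicator (cell v) y * (1 / norm (x - y) ^ (2 * CARD('d))))"
    for x y
  have "\<bar>f x y\<bar> \<le> 1" for x y
  proof (cases "x \<in> cell u \<and> y \<in> cell v")
    case True
    then have "\<bar>(x - y) $ i\<bar> \<ge> 1"
      using i by (auto simp: cell_iff dest!: spec[of _ i])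
    then have "norm (x - y) \<ge> 1"
      using component_le_norm_cart[of "x - y" i] by linarith
    then have "1 \<le> norm (x - y) ^ (2 * CARD('d))"
      by (rule one_le_power)
    then have "1 / norm (x - y) ^ (2 * CARD('d)) \<le> 1"
      by (subst divide_le_eq_1) linarith
    then show ?thesis
      using True by (simp add: f_def)
  qed (auto simp: f_def)
  then have bound: "AE z in lborel \<Otimes>\<^sub>M lborel. norm (case_prod f z) \<le> 1"
    by auto
  have fin: "emeasure (lborel \<Otimes>\<^sub>M lborel) (cell u \<times> cell v) < \<infinity>"
    using emeasure_cell_finite[of u] emeasure_cell_finite[of v]
    by (simp add: lborel.emeasure_pair_measure_Times ennreal_mult_less_top)
  have "integrable (lborel \<Otimes>\<^sub>M lborel) (case_prod f)"
  proof (rule integrableI_bounded_set[of "cell u \<times> cell v" _ _ 1])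
    show "cell u \<times> cell v \<in> sets (lborel \<Otimes>\<^sub>M lborel)"
      by auto
    show "case_prod f \<in> borel_measurable (lborel \<Otimes>\<^sub>M lborel)"
      unfolding f_def by measurable
    show "AE z in lborel \<Otimes>\<^sub>M lborel. z \<in> cell u \<times> cell v \<longrightarrow> norm (case_prod f z) \<le> 1"
      using bound by auto
    show "AE z in lborel \<Otimes>\<^sub>M lborel. z \<notin> cell u \<times> cell v \<longrightarrow> case_prod f z = 0"
      by (intro AE_I2) (auto simp: f_def indicator_def)
  qed (fact fin)
  then have "(LINT y|lborel. LINT x|lborel. f x y) = (LINT x|lborel. LINT y|lborel. f x y)"
    by (rule lborel_pair.Fubini_integral)
  moreover have "(LINT x|lborel. LINT y|lborel. f x y) =
      (LINT x:cell u|lborel. LINT y:cell v|lborel. 1 / norm (x - y) ^ (2 * CARD('d)))"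
    unfolding set_lebesgue_integral_def integral_scaleR_right[symmetric]
    by (intro Bochner_Integration.integral_cong refl) (auto simp: f_def norm_minus_commute)
  moreover have "(LINT y|lborel. LINT x|lborel. f x y) =
      (LINT y:cell v|lborel. LINT x:cell u|lborel. 1 / norm (y - x) ^ (2 * CARD('d)))"
    unfolding set_lebesgue_integral_def integral_scaleR_right[symmetric]
    by (intro Bochner_Integration.integral_cong refl) (auto simp: f_def norm_minus_commute)
  ultimately show ?thesis
    using False by (simp add: pair_prob_def infnorm_sub)
qed

lemma edge_prob_eq:
  assumes "u \<noteq> v"
  shows "edge_prob \<beta> {u, v} = pair_prob \<beta> u v"
  unfolding edge_prob_def
proof (rule the_equality)
  show "p = pair_prob \<beta> u v" if "\<exists>u' v'. {u, v} = {u', v'} \<and> p = pair_prob \<beta> u' v'" for p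
    using that pair_prob_commute[OF assms] by (auto simp: doubleton_eq_iff)
qed blast

end

theory Submission
  imports Defs
begin

text \<open>
  The connection probabilities are scale invariant: merging the blocks of side \<open>m\<close> into single
  vertices turns the model on the box of side \<open>m * n\<close> into the model on the box of side \<open>n\<close>, and the
  edges between blocks are independent of those inside. Following a coarse geodesic through the
  blocks makes \<open>Lambda\<close> submultiplicative, so the exponent exists and is at most
  \<open>ln (Lambda n) / ln n\<close> for every \<open>n\<close>. If \<open>n\<close> is a small power of \<open>\<beta>\<close>, any two points of the box
  of side \<open>n\<close> are directly connected up to an error probability \<open>O(1 / n)\<close>, hence \<open>Lambda n\<close> is
  bounded, which gives the upper bound.

  For the lower bound, the expected number of self-avoiding walks of length \<open>t\<close> from the origin is at
  most \<open>(C * \<beta>) ^ t\<close>, and a fixed proportion of steps longer than \<open>r\<close> costs a further factor that is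
  exponential in \<open>t\<close> with base a negative power of \<open>r\<close>. For \<open>r\<close> a large power of \<open>\<beta>\<close>, all walks of
  length \<open>t\<close> therefore consist mostly of short steps and collapse to coarse walks of length at most
  \<open>t / 2\<close> at scale \<open>M = 10 * r\<close>. So distances at least double when the side of the box is multiplied
  by \<open>M\<close>, and the exponent is at least \<open>ln 2 / ln M\<close>.
\<close>

subsection \<open>Geometry of the lattice\<close>

text \<open>Merging blocks is exact because the kernel is homogeneous of degree
  \<open>- 2 * d\<close> while the two integrations scale with degree \<open>2 * d\<close>. Where
  cells touch, the integral may diverge, but there the model prescribes probability one, and
  touching blocks contain touching vertices.

  The obstacle to the lower bound is that the mean number of steps out of a vertex grows with
  \<beta>, so counting walks alone gives nothing; only long steps gain. A step of length
  \<open>k\<close> has a spare factor \<open>1 / sqrt k\<close> beyond what summability costs. With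
  \<open>r = q ^ 20\<close> a long step gains \<open>q ^ 10\<close>, so a tenth of long steps gains
  \<open>q\<close> per step, which beats the growth \<open>2 * \<beta> * C\<close> of the walk count
  once \<open>q \<ge> 8 * \<beta> * C\<close>. Such a scale is a fixed power of \<beta> up to a
  constant, hence has logarithm of order \<open>ln \<beta>\<close>.

  Each doubling may fail, but with probability exponentially small in a length that itself doubles,
  so the failures are summable over all scales.

  Submultiplicativity bounds the exponent only from above. The lower bound reads the limit along the
  renormalised sides, which is legitimate only once convergence is proved; otherwise
  \<open>lim\<close> carries no information.\<close>

definition idist :: "int ^ 'd::finite \<Rightarrow> int ^ 'd \<Rightarrow> nat" where
  "idist u v = Max (range (\<lambda>i. nat \<bar>u $ i - v $ i\<bar>))"

lemma idist_le_iff: "idist u v \<le> k \<longleftrightarrow> (\<forall>i. \<bar>u $ i - v $ i\<bar> \<le> int k)"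
  by (auto simp: idist_def nat_le_iff)

lemma idist_comp_le: "\<bar>u $ i - v $ i\<bar> \<le> int (idist u v)"
  using idist_le_iff[of u v "idist u v"] by simp

lemma idist_attained: "\<exists>i. \<bar>u $ i - v $ i\<bar> = int (idist u v)"
proof -
  have "idist u v \<in> range (\<lambda>i. nat \<bar>u $ i - v $ i\<bar>)"
    unfolding idist_def by (intro Max_in) auto
  then show ?thesis by auto
qed

lemma idist_eq_0_iff [simp]: "idist u v = 0 \<longleftrightarrow> u = v"
  using idist_le_iff[of u v 0] by (auto simp: vec_eq_iff)

lemma idist_same [simp]: "idist u u = 0"
  by simp

lemma idist_triangle: "idist u w \<le> idist u v + idist v w"
  unfolding idist_le_iff
proof
  fix i
  show "\<bar>u $ i - w $ i\<bar> \<le> int (idist u v + idist v w)"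
    using idist_comp_le[of u i v] idist_comp_le[of v i w] by simp
qed

text \<open>Links \<open>idist\<close> to the maximum norm of the model; from here on the geometry
  is arithmetic of natural numbers.\<close>

lemma infnorm_lattice_point:
  "infnorm (lattice_point u - lattice_point v) = real (idist u v)"
proof -
  have "infnorm (lattice_point u - lattice_point v)
      = Sup {\<bar>(lattice_point u - lattice_point v) $ i\<bar> | i. i \<in> UNIV}"
    by (simp add: infnorm_cart)
  also have "\<dots> = real (idist u v)"
  proof (rule cSup_eq_maximum)
    obtain i where "\<bar>u $ i - v $ i\<bar> = int (idist u v)"
      using idist_attained by blast
    then have "real (idist u v) = \<bar>(lattice_point u - lattice_point v) $ i\<bar>"
      by (simp add: lattice_point_def flip: of_int_diff of_int_abs)
    then show "real (idist u v) \<in> {\<bar>(lattice_point u - lattice_point v) $ i\<bar> | i. i \<in> UNIV}"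
      by blast
  next
    fix x
    assume "x \<in> {\<bar>(lattice_point u - lattice_point v) $ i\<bar> | i. i \<in> UNIV}"
    then obtain i where "x = real_of_int \<bar>u $ i - v $ i\<bar>"
      by (auto simp: lattice_point_def)
    then show "x \<le> real (idist u v)"
      using idist_comp_le[of u i v] by linarith
  qed
  finally show ?thesis .
qed

lemma finite_lattice_box [simp, intro]: "finite (lattice_box n :: (int ^ 'd::finite) set)"
proof -
  have "(lattice_box n :: (int ^ 'd) set) \<subseteq> vec_lambda ` (Pi\<^sub>E UNIV (\<lambda>_. {0..<int n}))"
  proof
    fix u :: "int ^ 'd"
    assume "u \<in> lattice_box n"
    then have "vec_nth u \<in> Pi\<^sub>E UNIV (\<lambda>_. {0..<int n})"
      by (auto simp: lattice_box_def)
    then show "u \<in> vec_lambda ` (Pi\<^sub>E UNIV (\<lambda>_. {0..<int n}))"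
      by (metis image_eqI vec_nth_inverse)
  qed
  then show ?thesis
    by (rule finite_subset) (auto intro!: finite_PiE)
qed

lemma idist_box_less: "u \<in> lattice_box n \<Longrightarrow> v \<in> lattice_box n \<Longrightarrow> n \<ge> 1 \<Longrightarrow> idist u v \<le> n - 1"
  unfolding idist_le_iff lattice_box_def
  by (auto simp: abs_le_iff) (smt (verit, ccfv_threshold) of_nat_diff of_nat_1)+

subsection \<open>Graph distance\<close>

lemma open_step_iff:
  "(u, v) \<in> open_step \<omega> A \<longleftrightarrow> u \<in> A \<and> v \<in> A \<and> u \<noteq> v \<and> \<omega> {u, v}"
  by (auto simp: open_step_def edges_def doubleton_eq_iff)

lemma graph_dist_le: "(u, v) \<in> open_step \<omega> A ^^ k \<Longrightarrow> graph_dist \<omega> A u v \<le> enat k"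
  unfolding graph_dist_def by (rule Inf_lower) auto

lemma graph_dist_attained:
  assumes "graph_dist \<omega> A u v \<noteq> \<infinity>"
  shows "\<exists>k. graph_dist \<omega> A u v = enat k \<and> (u, v) \<in> open_step \<omega> A ^^ k"
proof -
  let ?S = "{enat k | k. (u, v) \<in> open_step \<omega> A ^^ k}"
  have "?S \<noteq> {}"
  proof
    assume "?S = {}"
    then have "graph_dist \<omega> A u v = \<infinity>"
      unfolding graph_dist_def by (simp add: Inf_enat_def)
    then show False
      using assms by simp
  qed
  then have "Inf ?S \<in> ?S"
    by (auto simp: Inf_enat_def intro: LeastI)
  then show ?thesis
    unfolding graph_dist_def by auto
qed

lemma graph_dist_leD:
  assumes "graph_dist \<omega> A u v \<le> enat t"
  shows "\<exists>k\<le>t. (u, v) \<in> open_step \<omega> A ^^ k"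
proof -
  have "graph_dist \<omega> A u v \<noteq> \<infinity>"
    using assms by (metis enat_ord_simps(5) leD enat_ord_simps(4) enat.distinct(2) infinity_ileE)
  from graph_dist_attained[OF this] assms show ?thesis
    by auto
qed

lemma graph_dist_triangle:
  "graph_dist \<omega> A u w \<le> graph_dist \<omega> A u v + graph_dist \<omega> A v w"
proof (cases "graph_dist \<omega> A u v = \<infinity> \<or> graph_dist \<omega> A v w = \<infinity>")
  case True
  then show ?thesis by auto
next
  case False
  then obtain k l where k: "graph_dist \<omega> A u v = enat k" "(u, v) \<in> open_step \<omega> A ^^ k"
    and l: "graph_dist \<omega> A v w = enat l" "(v, w) \<in> open_step \<omega> A ^^ l"
    using graph_dist_attained by meson
  then have "(u, w) \<in> open_step \<omega> A ^^ (k + l)"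
    by (auto simp: relpow_add)
  then show ?thesis
    using graph_dist_le k l by (metis plus_enat_simps(1))
qed

text \<open>A graph homomorphism maps walks to walks of the same length. This covers translations
  and inclusions, but not the block map, which collapses the edges inside a block.\<close>

lemma graph_dist_image_le:
  assumes "\<And>x y. (x, y) \<in> open_step \<omega> A \<Longrightarrow> (h x, h y) \<in> open_step \<omega>' B"
  shows "graph_dist \<omega>' B (h u) (h v) \<le> graph_dist \<omega> A u v"
proof (cases "graph_dist \<omega> A u v = \<infinity>")
  case False
  then obtain k where k: "graph_dist \<omega> A u v = enat k" "(u, v) \<in> open_step \<omega> A ^^ k"
    using graph_dist_attained by meson
  have "(u, y) \<in> open_step \<omega> A ^^ k \<Longrightarrow> (h u, h y) \<in> open_step \<omega>' B ^^ k" for y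
    by (induction k arbitrary: y) (auto dest: assms)
  then show ?thesis
    using graph_dist_le[where k = k and \<omega> = \<omega>' and A = B] k by auto
qed simp

lemma graph_dist_mono:
  "open_step \<omega> A \<subseteq> open_step \<omega>' B \<Longrightarrow> graph_dist \<omega>' B u v \<le> graph_dist \<omega> A u v"
  using graph_dist_image_le[of \<omega> A "\<lambda>x. x" \<omega>' B] by auto

lemma graph_dist_self [simp]: "graph_dist \<omega> A u u = 0"
  using graph_dist_le[where k = 0 and u = u and v = u] by (simp add: zero_enat_def[symmetric])

lemma graph_dist_open: "u \<in> A \<Longrightarrow> v \<in> A \<Longrightarrow> u \<noteq> v \<Longrightarrow> \<omega> {u, v} \<Longrightarrow> graph_dist \<omega> A u v \<le> 1"
  using graph_dist_le[where k = 1 and u = u and v = v] by (simp add: open_step_iff one_enat_def)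

subsection \<open>Independent Bernoulli families\<close>

definition edges_in :: "(int ^ 'd) set \<Rightarrow> (int ^ 'd) set set" where
  "edges_in A = {{u, v} | u v. u \<in> A \<and> v \<in> A \<and> u \<noteq> v}"

lemma edges_in_iff: "{u, v} \<in> edges_in A \<longleftrightarrow> u \<in> A \<and> v \<in> A \<and> u \<noteq> v"
  by (auto simp: edges_in_def doubleton_eq_iff)

lemma edges_inE:
  assumes "e \<in> edges_in A"
  obtains u v where "e = {u, v}" "u \<in> A" "v \<in> A" "u \<noteq> v"
  using assms by (auto simp: edges_in_def)

lemma edges_in_mono: "A \<subseteq> B \<Longrightarrow> edges_in A \<subseteq> edges_in B"
  by (auto simp: edges_in_def)

lemma edges_in_subset_edges: "edges_in A \<subseteq> edges"
  by (auto simp: edges_in_def edges_def)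

lemma finite_edges_in [simp, intro]: "finite A \<Longrightarrow> finite (edges_in A)"
  by (rule finite_subset[of _ "Pow A"]) (auto simp: edges_in_def)

text \<open>All bits are false with probability the product of the \<open>1 - p e\<close>, and a
  distribution on \<open>bool\<close> is determined by its mass at \<open>False\<close>.\<close>

lemma map_Ex_Pi_bernoulli:
  fixes p :: "'a \<Rightarrow> real"
  assumes fin: "finite J" and p: "\<And>e. e \<in> J \<Longrightarrow> 0 \<le> p e \<and> p e \<le> 1"
  shows "map_pmf (\<lambda>\<omega>. \<exists>e\<in>J. \<omega> e) (Pi_pmf J False (\<lambda>e. bernoulli_pmf (p e)))
    = bernoulli_pmf (1 - (\<Prod>e\<in>J. 1 - p e))" (is "?L = ?R")
proof -
  let ?P = "Pi_pmf J False (\<lambda>e. bernoulli_pmf (p e))"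
  have prod: "0 \<le> (\<Prod>e\<in>J. 1 - p e)" "(\<Prod>e\<in>J. 1 - p e) \<le> 1"
    using p by (auto intro!: prod_nonneg prod_le_1)
  have "pmf ?L False = measure_pmf.prob ?P {\<omega>. \<not> (\<exists>e\<in>J. \<omega> e)}"
    by (simp add: pmf_map vimage_def)
  also have "\<dots> = measure_pmf.prob ?P (PiE_dflt J False (\<lambda>_. {False}))"
    by (rule measure_prob_cong_0) (use fin in \<open>auto simp: PiE_dflt_def pmf_Pi\<close>)
  also have "\<dots> = (\<Prod>e\<in>J. measure_pmf.prob (bernoulli_pmf (p e)) {False})"
    using fin by (rule measure_Pi_pmf_PiE_dflt)
  also have "\<dots> = (\<Prod>e\<in>J. 1 - p e)"
    using p by (intro prod.cong) (auto simp: measure_pmf_single)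
  finally have F: "pmf ?L False = pmf ?R False"
    using prod by simp
  moreover have "pmf ?L True = 1 - pmf ?L False" "pmf ?R True = 1 - pmf ?R False"
    using pmf_False_conv_True by (smt (verit))+
  ultimately show ?thesis
    by (intro pmf_eqI) (metis (full_types))
qed

text \<open>Distinct values of \<phi> use disjoint sets of bits, so the merged bits are again
  independent. The induction splits off one fibre \<open>J\<close> from \<open>E\<close>, and
  therefore generalises over \<open>E\<close>.\<close>

lemma map_fibre_Pi_bernoulli:
  fixes p :: "'a \<Rightarrow> real" and \<phi> :: "'a \<Rightarrow> 'b"
  assumes "finite E'" and "finite E" and "\<And>e. e \<in> E \<Longrightarrow> 0 \<le> p e \<and> p e \<le> 1"
  shows "map_pmf (\<lambda>\<omega> e'. e' \<in> E' \<and> (\<exists>e\<in>E. \<phi> e = e' \<and> \<omega> e))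
      (Pi_pmf E False (\<lambda>e. bernoulli_pmf (p e)))
    = Pi_pmf E' False (\<lambda>e'. bernoulli_pmf (1 - (\<Prod>e | e \<in> E \<and> \<phi> e = e'. 1 - p e)))"
  using assms
proof (induction E' arbitrary: E)
  case empty
  then show ?case by (simp add: map_pmf_const)
next
  case (insert a E')
  define J where "J = {e \<in> E. \<phi> e = a}"
  define K where "K = {e \<in> E. \<phi> e \<noteq> a}"
  have fin: "finite J" "finite K" and JK: "J \<inter> K = {}" "J \<union> K = E"
    using insert.prems by (auto simp: J_def K_def)
  let ?B = "\<lambda>e. bernoulli_pmf (p e)"
  let ?q = "\<lambda>e'. bernoulli_pmf (1 - (\<Prod>e | e \<in> E \<and> \<phi> e = e'. 1 - p e))"
  let ?G = "\<lambda>\<omega> e'. e' \<in> E' \<and> (\<exists>e\<in>K. \<phi> e = e' \<and> \<omega> e)"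
  have E: "Pi_pmf E False ?B = map_pmf (\<lambda>(f, g) x. if x \<in> J then f x else g x)
      (pair_pmf (Pi_pmf J False ?B) (Pi_pmf K False ?B))"
    using Pi_pmf_union[OF fin JK(1), of False ?B] JK(2) by simp
  have IH: "map_pmf ?G (Pi_pmf K False ?B)
      = Pi_pmf E' False (\<lambda>e'. bernoulli_pmf (1 - (\<Prod>e | e \<in> K \<and> \<phi> e = e'. 1 - p e)))"
    using insert.prems by (intro insert.IH) (auto simp: K_def)
  also have "\<dots> = Pi_pmf E' False ?q"
  proof (rule Pi_pmf_cong)
    fix e'
    assume "e' \<in> E'"
    then have "{e. e \<in> K \<and> \<phi> e = e'} = {e. e \<in> E \<and> \<phi> e = e'}"
      using insert.hyps by (auto simp: K_def)
    then show "bernoulli_pmf (1 - (\<Prod>e | e \<in> K \<and> \<phi> e = e'. 1 - p e)) = ?q e'"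
      by simp
  qed auto
  finally have IH: "map_pmf ?G (Pi_pmf K False ?B) = Pi_pmf E' False ?q" .
  have J: "map_pmf (\<lambda>\<omega>. \<exists>e\<in>J. \<omega> e) (Pi_pmf J False ?B) = ?q a"
    using map_Ex_Pi_bernoulli[of J p] insert.prems fin by (simp add: J_def)
  have "Pi_pmf (insert a E') False ?q
      = map_pmf (\<lambda>(y, f). f(a := y)) (pair_pmf (?q a) (Pi_pmf E' False ?q))"
    using insert.hyps by (intro Pi_pmf_insert) auto
  also have "\<dots> = map_pmf (\<lambda>(y, f). f(a := y)) (map_pmf (map_prod (\<lambda>\<omega>. \<exists>e\<in>J. \<omega> e) ?G)
      (pair_pmf (Pi_pmf J False ?B) (Pi_pmf K False ?B)))"
    by (simp only: J[symmetric] IH[symmetric] map_prod_def map_pair)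
  also have "\<dots> = map_pmf (\<lambda>\<omega> e'. e' \<in> insert a E' \<and> (\<exists>e\<in>E. \<phi> e = e' \<and> \<omega> e))
      (Pi_pmf E False ?B)"
    unfolding E map_pmf_comp
  proof (intro map_pmf_cong refl ext)
    fix fg :: "('a \<Rightarrow> bool) \<times> ('a \<Rightarrow> bool)" and e'
    show "(case map_prod (\<lambda>\<omega>. \<exists>e\<in>J. \<omega> e) ?G fg of (y, f) \<Rightarrow> f(a := y)) e' =
        (e' \<in> insert a E' \<and>
         (\<exists>e\<in>E. \<phi> e = e' \<and> (case fg of (f, g) \<Rightarrow> \<lambda>x. if x \<in> J then f x else g x) e))"
      using insert.hyps by (cases fg; cases "e' = a") (auto simp: J_def K_def)
  qed
  finally show ?case ..
qed

subsection \<open>The connection kernel\<close>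

text \<open>A nonnegative integral with values in \<open>ennreal\<close>: scaling and splitting then
  require only measurability, and the value may be infinite for touching cells.\<close>

definition kernel_mass :: "(real ^ 'd::finite) set \<Rightarrow> (real ^ 'd) set \<Rightarrow> ennreal" where
  "kernel_mass A B = (\<integral>\<^sup>+ x. \<integral>\<^sup>+ y. indicator A x * (indicator B y *
      ennreal (1 / norm (x - y) ^ (2 * CARD('d)))) \<partial>lborel \<partial>lborel)"

lemma emeasure_cell: "emeasure lborel (cell (u :: int ^ 'd::finite)) = 1"
proof (rule antisym)
  let ?a = "lattice_point u :: real ^ 'd"
  have b: "(?a + 1 - ?a) \<bullet> b = 1" "?a \<bullet> b \<le> (?a + 1) \<bullet> b" if "b \<in> Basis" for b
    using that by (auto simp: Basis_vec_def inner_axis)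
  have "cell u \<subseteq> cbox ?a (?a + 1)"
    by (auto simp: cell_iff mem_box_cart lattice_point_def less_imp_le)
  then have "emeasure lborel (cell u) \<le> emeasure lborel (cbox ?a (?a + 1))"
    by (intro emeasure_mono) auto
  also have "\<dots> = 1"
    using b by (subst emeasure_lborel_cbox) (auto simp: prod_ennreal)
  finally show "emeasure lborel (cell u) \<le> 1" .
  have "1 = emeasure lborel (box ?a (?a + 1))"
    using b by (subst emeasure_lborel_box) (auto simp: prod_ennreal)
  also have "\<dots> \<le> emeasure lborel (cell u)"
    by (intro emeasure_mono) (auto simp: cell_iff mem_box_cart lattice_point_def less_imp_le)
  finally show "1 \<le> emeasure lborel (cell u)" .
qed

lemma nn_integral_lborel_affine:
  fixes f :: "'a::euclidean_space \<Rightarrow> ennreal"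
  assumes [measurable]: "f \<in> borel_measurable borel" and c: "c \<noteq> 0"
  shows "(\<integral>\<^sup>+ x. f x \<partial>lborel) = ennreal (\<bar>c\<bar> ^ DIM('a)) * (\<integral>\<^sup>+ x. f (t + c *\<^sub>R x) \<partial>lborel)"
  by (subst lborel_affine[OF c, of t])
     (simp add: nn_integral_density nn_integral_distr nn_integral_cmult)

text \<open>The substitution contributes \<open>c ^ d\<close> for each of the two variables and
  \<open>1 / c ^ (2 * d)\<close> from the kernel. Their cancellation is the reason for the exponent
  \<open>2 * d\<close> and the source of scale invariance.\<close>

lemma kernel_mass_affine:
  fixes A B :: "(real ^ 'd::finite) set"
  assumes [measurable]: "A \<in> sets borel" "B \<in> sets borel" and c: "c > 0"
  shows "kernel_mass A B = kernel_mass {x. t + c *\<^sub>R x \<in> A} {x. t + c *\<^sub>R x \<in> B}"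
proof -
  let ?d = "CARD('d)"
  let ?k = "\<lambda>x y. ennreal (1 / norm (x - y) ^ (2 * ?d))"
  let ?A' = "{x. t + c *\<^sub>R x \<in> A}" and ?B' = "{x. t + c *\<^sub>R x \<in> B}"
  have k: "?k (t + c *\<^sub>R x) (t + c *\<^sub>R y) = ennreal (1 / c ^ (2 * ?d)) * ?k x y"
    for x y :: "real ^ 'd"
  proof -
    have "t + c *\<^sub>R x - (t + c *\<^sub>R y) = c *\<^sub>R (x - y)"
      by (simp add: algebra_simps)
    then have "norm (t + c *\<^sub>R x - (t + c *\<^sub>R y)) = c * norm (x - y)"
      using c by simp
    then show ?thesis
      using c by (simp add: power_mult_distrib ennreal_mult[symmetric] divide_simps)
  qed
  have "kernel_mass A B = (\<integral>\<^sup>+ x. ennreal (c ^ ?d) * (\<integral>\<^sup>+ y. indicator A x *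
      (indicator B (t + c *\<^sub>R y) * ?k x (t + c *\<^sub>R y)) \<partial>lborel) \<partial>lborel)"
    unfolding kernel_mass_def
    by (subst nn_integral_lborel_affine[where c = c and t = t]) (use c in auto)
  also have "\<dots> = ennreal (c ^ ?d) * (\<integral>\<^sup>+ x. ennreal (c ^ ?d) * (\<integral>\<^sup>+ y. indicator A (t + c *\<^sub>R x) *
      (indicator B (t + c *\<^sub>R y) * ?k (t + c *\<^sub>R x) (t + c *\<^sub>R y)) \<partial>lborel) \<partial>lborel)"
    by (subst nn_integral_lborel_affine[where c = c and t = t]) (use c in auto)
  also have "\<dots> = ennreal (c ^ ?d) * (\<integral>\<^sup>+ x. ennreal (c ^ ?d) * (\<integral>\<^sup>+ y. ennreal (1 / c ^ (2 * ?d)) *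
      (indicator A (t + c *\<^sub>R x) * (indicator B (t + c *\<^sub>R y) * ?k x y)) \<partial>lborel) \<partial>lborel)"
    unfolding k by (simp add: mult_ac)
  also have "\<dots> = ennreal (c ^ ?d) * (ennreal (c ^ ?d) * (ennreal (1 / c ^ (2 * ?d)) *
      kernel_mass {x. t + c *\<^sub>R x \<in> A} {x. t + c *\<^sub>R x \<in> B}))"
  proof -
    have "(\<lambda>x. t + c *\<^sub>R x) -` A \<in> sets borel" "(\<lambda>x. t + c *\<^sub>R x) -` B \<in> sets borel"
      by (rule measurable_sets_borel[OF _ assms(1)] measurable_sets_borel[OF _ assms(2)], simp)+
    then have [measurable]: "?A' \<in> sets borel" "?B' \<in> sets borel"
      by (simp_all add: vimage_def)
    have ind: "indicator A (t + c *\<^sub>R x) = (indicator ?A' x :: ennreal)"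
      "indicator B (t + c *\<^sub>R x) = (indicator ?B' x :: ennreal)" for x
      by (auto simp: indicator_def)
    define F where "F x y = indicator ?A' x * (indicator ?B' y * ?k x y)" for x y
    have [measurable]: "case_prod F \<in> borel_measurable (lborel \<Otimes>\<^sub>M lborel)"
      unfolding F_def by measurable
    have in_y: "(\<integral>\<^sup>+ y. b * F x y \<partial>lborel) = b * (\<integral>\<^sup>+ y. F x y \<partial>lborel)" for b x
      by (rule nn_integral_cmult) measurable
    have in_x: "(\<integral>\<^sup>+ x. b * (\<integral>\<^sup>+ y. F x y \<partial>lborel) \<partial>lborel)
        = b * (\<integral>\<^sup>+ x. \<integral>\<^sup>+ y. F x y \<partial>lborel \<partial>lborel)" for b
      by (rule nn_integral_cmult) measurable
    show ?thesis
      unfolding ind kernel_mass_def F_def[symmetric] in_y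
      by (simp only: mult.assoc[symmetric] in_x)
  qed
  also have "\<dots> = ennreal (c ^ ?d * (c ^ ?d * (1 / c ^ (2 * ?d)))) *
      kernel_mass {x. t + c *\<^sub>R x \<in> A} {x. t + c *\<^sub>R x \<in> B}"
    using c by (simp only: ennreal_mult zero_le_power less_imp_le mult_nonneg_nonneg
        divide_nonneg_nonneg zero_le_one mult.assoc)
  also have "c ^ ?d * (c ^ ?d * (1 / c ^ (2 * ?d))) = 1"
    using c by (simp add: power_add[symmetric] mult_2)
  finally show ?thesis by simp
qed

text \<open>Disjoint decompositions of \<open>S\<close> and \<open>T\<close> enter through their
  indicators, the form in which the integrand itself splits.\<close>

lemma kernel_mass_sum:
  fixes A B :: "'i \<Rightarrow> (real ^ 'd::finite) set"
  assumes "finite I" "finite J"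
    and [measurable]: "\<And>i. i \<in> I \<Longrightarrow> A i \<in> sets borel" "\<And>j. j \<in> J \<Longrightarrow> B j \<in> sets borel"
    and S: "\<And>x. indicator S x = (\<Sum>i\<in>I. indicator (A i) x :: ennreal)"
    and T: "\<And>x. indicator T x = (\<Sum>j\<in>J. indicator (B j) x :: ennreal)"
  shows "kernel_mass S T = (\<Sum>i\<in>I. \<Sum>j\<in>J. kernel_mass (A i) (B j))"
proof -
  have prod: "(\<Sum>i\<in>I. a i) * ((\<Sum>j\<in>J. b j) * k) = (\<Sum>i\<in>I. \<Sum>j\<in>J. a i * (b j * k))"
    for a b :: "'i \<Rightarrow> ennreal" and k
    by (subst sum_distrib_right) (simp add: sum_distrib_right sum_distrib_left)
  have "kernel_mass S T = (\<integral>\<^sup>+ x. \<integral>\<^sup>+ y. (\<Sum>i\<in>I. \<Sum>j\<in>J. indicator (A i) x * (indicator (B j) y *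
      ennreal (1 / norm (x - y) ^ (2 * CARD('d))))) \<partial>lborel \<partial>lborel)"
    unfolding kernel_mass_def S T prod ..
  also have "\<dots> = (\<Sum>i\<in>I. \<Sum>j\<in>J. kernel_mass (A i) (B j))"
    unfolding kernel_mass_def by (simp add: nn_integral_sum)
  finally show ?thesis .
qed

lemma kernel_mass_bounds:
  fixes u v :: "int ^ 'd::finite"
  assumes lo: "\<And>x y. x \<in> cell u \<Longrightarrow> y \<in> cell v \<Longrightarrow> a \<le> 1 / norm (x - y) ^ (2 * CARD('d))"
    and hi: "\<And>x y. x \<in> cell u \<Longrightarrow> y \<in> cell v \<Longrightarrow> 1 / norm (x - y) ^ (2 * CARD('d)) \<le> b"
  shows "ennreal a \<le> kernel_mass (cell u) (cell v)" "kernel_mass (cell u) (cell v) \<le> ennreal b"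
proof -
  have c: "(\<integral>\<^sup>+ x. \<integral>\<^sup>+ y. indicator (cell u) x * (indicator (cell v) y * ennreal c) \<partial>lborel \<partial>lborel)
      = ennreal c" for c
  proof -
    have "(\<integral>\<^sup>+ x. \<integral>\<^sup>+ y. indicator (cell u) x * (indicator (cell v) y * ennreal c) \<partial>lborel \<partial>lborel)
      = (\<integral>\<^sup>+ x. indicator (cell u) x * ennreal c \<partial>lborel)"
      by (simp add: nn_integral_cmult nn_integral_multc emeasure_cell)
    also have "\<dots> = ennreal c"
      by (simp add: nn_integral_multc emeasure_cell)
    finally show ?thesis .
  qed
  show "ennreal a \<le> kernel_mass (cell u) (cell v)"
    by (subst c[of a, symmetric], unfold kernel_mass_def, intro nn_integral_mono)
       (simp add: indicator_def ennreal_leI lo)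
  show "kernel_mass (cell u) (cell v) \<le> ennreal b"
    by (subst c[of b, symmetric], unfold kernel_mass_def, intro nn_integral_mono)
       (simp add: indicator_def ennreal_leI hi)
qed

lemma norm_cell_diff_ge:
  fixes u v :: "int ^ 'd::finite"
  assumes "x \<in> cell u" "y \<in> cell v"
  shows "real (idist u v) - 1 \<le> norm (x - y)"
proof -
  obtain i where i: "\<bar>u $ i - v $ i\<bar> = int (idist u v)"
    using idist_attained by blast
  have x: "real_of_int (u $ i) \<le> x $ i" "x $ i < real_of_int (u $ i) + 1"
    and y: "real_of_int (v $ i) \<le> y $ i" "y $ i < real_of_int (v $ i) + 1"
    using assms by (auto simp: cell_iff)
  have "real (idist u v) = \<bar>real_of_int (u $ i) - real_of_int (v $ i)\<bar>"
    using i by (simp flip: of_int_diff of_int_abs)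
  also have "\<dots> \<le> \<bar>(x - y) $ i\<bar> + 1"
    using x y by (simp add: abs_if split: if_splits)
  finally show ?thesis
    using component_le_norm_cart[of "x - y" i] by linarith
qed

lemma norm_cell_diff_le:
  fixes u v :: "int ^ 'd::finite"
  assumes "x \<in> cell u" "y \<in> cell v"
  shows "norm (x - y) \<le> real CARD('d) * (real (idist u v) + 1)"
proof -
  have "\<bar>(x - y) $ i\<bar> \<le> real (idist u v) + 1" for i
  proof -
    have "\<bar>real_of_int (u $ i) - real_of_int (v $ i)\<bar> \<le> real (idist u v)"
      using idist_comp_le[of u i v] by (simp flip: of_int_diff of_int_abs)
    moreover have x: "real_of_int (u $ i) \<le> x $ i" "x $ i < real_of_int (u $ i) + 1"
      and y: "real_of_int (v $ i) \<le> y $ i" "y $ i < real_of_int (v $ i) + 1"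
      using assms by (auto simp: cell_iff)
    ultimately show ?thesis
      by (simp add: abs_if split: if_splits)
  qed
  then have "(\<Sum>i\<in>UNIV. \<bar>(x - y) $ i\<bar>) \<le> (\<Sum>i\<in>(UNIV :: 'd set). real (idist u v) + 1)"
    by (intro sum_mono) auto
  with norm_le_l1_cart[of "x - y"] show ?thesis
    by simp
qed

text \<open>An infinite mass would become 0 here. The value represents the mass when
  \<open>idist u v \<ge> 2\<close>, where finiteness is proved.\<close>

definition kernel_weight :: "int ^ 'd::finite \<Rightarrow> int ^ 'd \<Rightarrow> real" where
  "kernel_weight u v = enn2real (kernel_mass (cell u) (cell v))"

lemma kernel_weight_nonneg [simp]: "0 \<le> kernel_weight u v"
  by (simp add: kernel_weight_def)

lemma kernel_mass_cell_le:
  fixes u v :: "int ^ 'd::finite"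
  assumes "idist u v \<ge> 2"
  shows "kernel_mass (cell u) (cell v) \<le> ennreal (1 / (real (idist u v) - 1) ^ (2 * CARD('d)))"
proof (rule kernel_mass_bounds(2))
  show "0 \<le> 1 / norm (x - y) ^ (2 * CARD('d))" for x y :: "real ^ 'd"
    by simp
  fix x y :: "real ^ 'd"
  assume "x \<in> cell u" "y \<in> cell v"
  then have "real (idist u v) - 1 \<le> norm (x - y)"
    by (rule norm_cell_diff_ge)
  then show "1 / norm (x - y) ^ (2 * CARD('d)) \<le> 1 / (real (idist u v) - 1) ^ (2 * CARD('d))"
    using assms by (intro divide_left_mono power_mono mult_pos_pos zero_less_power) auto
qed

lemma kernel_mass_cell_finite: "idist u v \<ge> 2 \<Longrightarrow> kernel_mass (cell u) (cell v) < \<infinity>"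
  using kernel_mass_cell_le by (metis ennreal_less_top infinity_ennreal_def le_less_trans)

lemma ennreal_kernel_weight:
  "idist u v \<ge> 2 \<Longrightarrow> ennreal (kernel_weight u v) = kernel_mass (cell u) (cell v)"
  unfolding kernel_weight_def using kernel_mass_cell_finite[of u v] by (simp add: less_top)

lemma kernel_weight_le:
  fixes u v :: "int ^ 'd::finite"
  assumes "idist u v \<ge> 2"
  shows "kernel_weight u v \<le> 1 / (real (idist u v) - 1) ^ (2 * CARD('d))"
  unfolding kernel_weight_def using kernel_mass_cell_le[OF assms]
  by (intro enn2real_leI) auto

lemma kernel_weight_ge:
  fixes u v :: "int ^ 'd::finite"
  assumes "idist u v \<ge> 2"
  shows "1 / (real CARD('d) * (real (idist u v) + 1)) ^ (2 * CARD('d)) \<le> kernel_weight u v"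
proof -
  have "ennreal (1 / (real CARD('d) * (real (idist u v) + 1)) ^ (2 * CARD('d)))
      \<le> kernel_mass (cell u) (cell v)"
  proof (rule kernel_mass_bounds(1)[where b = "1 / (real (idist u v) - 1) ^ (2 * CARD('d))"])
    fix x y :: "real ^ 'd"
    assume xy: "x \<in> cell u" "y \<in> cell v"
    then have le: "real (idist u v) - 1 \<le> norm (x - y)"
      "norm (x - y) \<le> real CARD('d) * (real (idist u v) + 1)"
      by (auto intro: norm_cell_diff_ge norm_cell_diff_le)
    moreover have pos: "0 < real (idist u v) - 1"
      using assms by simp
    ultimately have "0 < norm (x - y)"
      by linarith
    show "1 / (real CARD('d) * (real (idist u v) + 1)) ^ (2 * CARD('d))
        \<le> 1 / norm (x - y) ^ (2 * CARD('d))"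
      using le \<open>0 < norm (x - y)\<close>
      by (intro divide_left_mono power_mono mult_pos_pos zero_less_power) auto
    show "1 / norm (x - y) ^ (2 * CARD('d)) \<le> 1 / (real (idist u v) - 1) ^ (2 * CARD('d))"
      using le pos by (intro divide_left_mono power_mono mult_pos_pos zero_less_power) auto
  qed
  then show ?thesis
    unfolding ennreal_kernel_weight[OF assms, symmetric] by (simp add: ennreal_le_iff)
qed

lemma pair_prob_adjacent: "idist u v = 1 \<Longrightarrow> pair_prob \<beta> u v = 1"
  by (simp add: pair_prob_def infnorm_lattice_point)

text \<open>The bridge from the iterated Bochner integral of the model to
  \<open>kernel_mass\<close>. At distance at least 2 the kernel is at most 1 on the two unit cells,
  so the inner integral \<open>g\<close> is finite and \<open>enn2real\<close> loses
  nothing.\<close>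

lemma pair_prob_far:
  fixes u v :: "int ^ 'd::finite"
  assumes far: "idist u v \<ge> 2"
  shows "pair_prob \<beta> u v = 1 - exp (- \<beta> * kernel_weight u v)"
proof -
  let ?k = "\<lambda>x y. 1 / norm (x - y) ^ (2 * CARD('d)) :: real"
  define g where "g x = (\<integral>\<^sup>+ y. indicator (cell v) y * ennreal (?k x y) \<partial>lborel)" for x
  have [measurable]: "g \<in> borel_measurable borel"
    unfolding g_def by measurable
  have g1: "g x \<le> 1" if "x \<in> cell u" for x
  proof -
    have "g x \<le> (\<integral>\<^sup>+ y. indicator (cell v) y \<partial>lborel)"
      unfolding g_def
    proof (intro nn_integral_mono)
      fix y
      show "indicator (cell v) y * ennreal (?k x y) \<le> indicator (cell v) y"
      proof (cases "y \<in> cell v")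
        case True
        have "1 \<le> norm (x - y)"
          using norm_cell_diff_ge[OF that True] far by linarith
        then have "1 \<le> norm (x - y) ^ (2 * CARD('d))"
          by (rule one_le_power)
        then have "?k x y \<le> 1"
          by (subst divide_le_eq_1) linarith
        then show ?thesis
          using True by (simp add: ennreal_le_1)
      qed simp
    qed
    also have "\<dots> = 1"
      by (simp add: emeasure_cell)
    finally show ?thesis .
  qed
  have inner: "(LINT y:cell v|lborel. ?k x y) = enn2real (g x)" for x
    unfolding set_lebesgue_integral_def g_def
    by (subst integral_eq_nn_integral)
       (auto simp: ennreal_mult ennreal_indicator simp flip: times_divide_eq_right
         intro!: arg_cong[where f = enn2real] nn_integral_cong)
  have "(LINT x:cell u|lborel. LINT y:cell v|lborel. ?k x y)
      = (LINT x:cell u|lborel. enn2real (g x))"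
    unfolding inner ..
  also have "\<dots> = enn2real (\<integral>\<^sup>+ x. ennreal (indicator (cell u) x * enn2real (g x)) \<partial>lborel)"
    unfolding set_lebesgue_integral_def
    by (subst integral_eq_nn_integral) auto
  also have "(\<integral>\<^sup>+ x. ennreal (indicator (cell u) x * enn2real (g x)) \<partial>lborel)
      = kernel_mass (cell u) (cell v)"
    unfolding kernel_mass_def
  proof (intro nn_integral_cong)
    fix x :: "real ^ 'd"
    show "ennreal (indicator (cell u) x * enn2real (g x)) =
      (\<integral>\<^sup>+ y. indicator (cell u) x * (indicator (cell v) y * ennreal (?k x y)) \<partial>lborel)"
    proof (cases "x \<in> cell u")
      case True
      then have "g x < \<top>"
        using g1 le_less_trans ennreal_one_less_top by blast
      then show ?thesis
        using True by (simp only: indicator_simps g_def mult_1 ennreal_enn2real)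
    next
      case False
      then show ?thesis
        by (simp only: indicator_simps(2)[OF False] mult_zero_left) simp
    qed
  qed
  finally have "(LINT x:cell u|lborel. LINT y:cell v|lborel. ?k x y) = kernel_weight u v"
    by (simp only: kernel_weight_def)
  moreover have "infnorm (lattice_point u - lattice_point v) \<noteq> 1"
    using far by (simp add: infnorm_lattice_point)
  ultimately show ?thesis
    by (simp only: pair_prob_def if_False)
qed

lemma pair_prob_bounds:
  assumes "\<beta> \<ge> 0" "u \<noteq> v"
  shows "0 \<le> pair_prob \<beta> u v \<and> pair_prob \<beta> u v \<le> 1"
proof (cases "idist u v \<ge> 2")
  case True
  then show ?thesis
    using assms by (simp add: pair_prob_far)
next
  case False
  then have "idist u v = 1"
    using assms idist_eq_0_iff[of u v] by linarith
  then show ?thesis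
    by (simp add: pair_prob_adjacent)
qed

lemma edge_prob_bounds: "\<beta> \<ge> 0 \<Longrightarrow> e \<in> edges \<Longrightarrow> 0 \<le> edge_prob \<beta> e \<and> edge_prob \<beta> e \<le> 1"
  by (auto simp: edges_def edge_prob_eq pair_prob_bounds)

subsection \<open>Finite boxes\<close>

definition box_pmf :: "real \<Rightarrow> (int ^ 'd::finite) set \<Rightarrow> ((int ^ 'd) set \<Rightarrow> bool) pmf" where
  "box_pmf \<beta> A = Pi_pmf (edges_in A) False (\<lambda>e. bernoulli_pmf (edge_prob \<beta> e))"

definition mean_dist :: "real \<Rightarrow> (int ^ 'd::finite) set \<Rightarrow> int ^ 'd \<Rightarrow> int ^ 'd \<Rightarrow> ennreal" where
  "mean_dist \<beta> A u v = (\<integral>\<^sup>+ \<omega>. ennreal_of_enat (graph_dist \<omega> A u v) \<partial>box_pmf \<beta> A)"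

lemma graph_dist_restrict:
  assumes "edges_in A \<subseteq> E"
  shows "graph_dist (\<lambda>e. e \<in> E \<and> \<omega> e) A = graph_dist \<omega> A"
proof -
  have "open_step (\<lambda>e. e \<in> E \<and> \<omega> e) A = open_step \<omega> A"
    using assms by (auto simp: open_step_iff edges_in_iff subset_iff)
  then show ?thesis
    by (simp add: graph_dist_def fun_eq_iff)
qed

text \<open>By \<open>F\<close>, the integrand depends only on the finitely many edges of
  \<open>E\<close>. It is therefore a finite combination of indicators of cylinders, one for each
  configuration on \<open>E\<close>, and the infinite product measure of a cylinder is the finite
  product.\<close>

lemma nn_integral_percolation:
  fixes F :: "((int ^ 'd::finite) set \<Rightarrow> bool) \<Rightarrow> ennreal"
  assumes fin: "finite E" and E: "E \<subseteq> edges" and F: "\<And>\<omega>. F (\<lambda>e. e \<in> E \<and> \<omega> e) = F \<omega>"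
  shows "(\<integral>\<^sup>+ \<omega>. F \<omega> \<partial>percolation \<beta>)
    = (\<integral>\<^sup>+ \<omega>. F \<omega> \<partial>Pi_pmf E False (\<lambda>e. bernoulli_pmf (edge_prob \<beta> e)))"
proof -
  let ?M = "\<lambda>e. measure_pmf (bernoulli_pmf (edge_prob \<beta> e))"
  let ?P = "Pi_pmf E False (\<lambda>e. bernoulli_pmf (edge_prob \<beta> e))"
  interpret product_prob_space ?M edges
    by standard
  define \<Omega> :: "((int ^ 'd) set \<Rightarrow> bool) set" where "\<Omega> = {f. \<forall>e. e \<notin> E \<longrightarrow> \<not> f e}"
  define cyl where "cyl f = {\<omega> \<in> space (percolation \<beta>). \<forall>e\<in>E. \<omega> e \<in> {f e}}" for f
  have "\<Omega> = PiE_dflt E False (\<lambda>_. UNIV)"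
    by (auto simp: \<Omega>_def PiE_dflt_def)
  then have fin_\<Omega>: "finite \<Omega>"
    using fin by auto
  have cyl_sets [measurable]: "cyl f \<in> sets (percolation \<beta>)" for f
    unfolding cyl_def percolation_def using fin E
    by (intro sets.sets_Collect_finite_All sets_Collect_single) auto
  have cyl: "emeasure (percolation \<beta>) (cyl f) = ennreal (pmf ?P f)" if "f \<in> \<Omega>" for f
  proof -
    have "emeasure (percolation \<beta>) (cyl f) = (\<Prod>e\<in>E. emeasure (?M e) {f e})"
      unfolding cyl_def percolation_def using fin E by (intro emeasure_PiM_Collect) auto
    also have "\<dots> = ennreal (pmf ?P f)"
      using that fin by (subst pmf_Pi') (auto simp: \<Omega>_def emeasure_pmf_single prod_ennreal)
    finally show ?thesis .
  qed
  have "(\<integral>\<^sup>+ \<omega>. F \<omega> \<partial>percolation \<beta>)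
      = (\<integral>\<^sup>+ \<omega>. (\<Sum>f\<in>\<Omega>. F f * indicator (cyl f) \<omega>) \<partial>percolation \<beta>)"
  proof (intro nn_integral_cong)
    fix \<omega> :: "(int ^ 'd) set \<Rightarrow> bool"
    assume \<omega>: "\<omega> \<in> space (percolation \<beta>)"
    let ?f = "\<lambda>e. e \<in> E \<and> \<omega> e"
    have f: "?f \<in> \<Omega>"
      by (auto simp: \<Omega>_def)
    have "indicator (cyl f) \<omega> = (if f = ?f then 1 else 0 :: ennreal)" if "f \<in> \<Omega>" for f
    proof -
      have "\<omega> \<in> cyl f \<longleftrightarrow> f = ?f"
        using that \<omega> by (auto simp: cyl_def \<Omega>_def fun_eq_iff)
      then show ?thesis
        unfolding indicator_def by (simp only: of_bool_def)
    qed
    then have "(\<Sum>f\<in>\<Omega>. F f * indicator (cyl f) \<omega>) = (\<Sum>f\<in>\<Omega>. if f = ?f then F f else 0)"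
      by (intro sum.cong) auto
    also have "\<dots> = F \<omega>"
      using f fin_\<Omega> F by (simp add: sum.delta')
    finally show "F \<omega> = (\<Sum>f\<in>\<Omega>. F f * indicator (cyl f) \<omega>)" ..
  qed
  also have "\<dots> = (\<Sum>f\<in>\<Omega>. F f * emeasure (percolation \<beta>) (cyl f))"
    by (subst nn_integral_sum) (auto simp: nn_integral_cmult_indicator)
  also have "\<dots> = (\<Sum>f\<in>\<Omega>. F f * pmf ?P f)"
    by (intro sum.cong) (auto simp: cyl)
  also have "\<dots> = (\<integral>\<^sup>+ \<omega>. F \<omega> \<partial>?P)"
    using set_Pi_pmf_subset[OF fin, of False "\<lambda>e. bernoulli_pmf (edge_prob \<beta> e)"]
    by (intro nn_integral_measure_pmf_support[symmetric]) (auto simp: \<Omega>_def intro: fin_\<Omega>[unfolded \<Omega>_def])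
  finally show ?thesis .
qed

lemma expected_dist_eq:
  "finite A \<Longrightarrow> expected_dist \<beta> A u v = enn2real (mean_dist \<beta> A u v)"
  unfolding expected_dist_def mean_dist_def box_pmf_def
  by (subst nn_integral_percolation[where E = "edges_in A"])
     (auto simp: graph_dist_restrict intro: edges_in_subset_edges[THEN subsetD])

text \<open>Distances inside \<open>B\<close> see only edges of \<open>B\<close>; the remaining
  independent edges of \<open>E\<close> are integrated out.\<close>

lemma nn_integral_graph_dist_sub:
  assumes "finite E" "edges_in B \<subseteq> E"
  shows "(\<integral>\<^sup>+ \<omega>. ennreal_of_enat (graph_dist \<omega> B u v)
      \<partial>Pi_pmf E False (\<lambda>e. bernoulli_pmf (edge_prob \<beta> e))) = mean_dist \<beta> B u v"
proof -
  have "box_pmf \<beta> B = map_pmf (\<lambda>\<omega> e. if e \<in> edges_in B then \<omega> e else False)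
      (Pi_pmf E False (\<lambda>e. bernoulli_pmf (edge_prob \<beta> e)))"
    unfolding box_pmf_def by (rule Pi_pmf_subset[OF assms])
  also have "(\<lambda>\<omega> e. if e \<in> edges_in B then \<omega> e else False) = (\<lambda>\<omega> e. e \<in> edges_in B \<and> \<omega> e)"
    by (auto simp: fun_eq_iff)
  finally show ?thesis
    unfolding mean_dist_def by (simp add: graph_dist_restrict)
qed

text \<open>Common form of two changes of graph: translation, where each fibre is a single edge, and
  merging of blocks, where a fibre consists of all edges between two blocks.\<close>

lemma map_fibre_box_pmf:
  fixes A B :: "(int ^ 'd::finite) set"
  assumes "finite A" "finite B" "\<beta> \<ge> 0"
    and "\<And>e'. e' \<in> edges_in B \<Longrightarrow>
      1 - (\<Prod>e | e \<in> edges_in A \<and> \<phi> e = e'. 1 - edge_prob \<beta> e) = edge_prob \<beta> e'"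
  shows "map_pmf (\<lambda>\<omega> e'. e' \<in> edges_in B \<and> (\<exists>e\<in>edges_in A. \<phi> e = e' \<and> \<omega> e)) (box_pmf \<beta> A)
    = box_pmf \<beta> B"
  unfolding box_pmf_def
  by (subst map_fibre_Pi_bernoulli)
     (use assms edge_prob_bounds[OF assms(3)] edges_in_subset_edges in
       \<open>auto intro!: Pi_pmf_cong\<close>)

subsection \<open>Translation invariance\<close>

lemma cell_translate: "{x. lattice_point w + 1 *\<^sub>R x \<in> cell (w + u)} = cell (u :: int ^ 'd::finite)"
  by (auto simp: cell_iff lattice_point_def)

lemma pair_prob_translate:
  fixes u v w :: "int ^ 'd::finite"
  assumes "u \<noteq> v"
  shows "pair_prob \<beta> (w + u) (w + v) = pair_prob \<beta> u v"
proof -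
  have idist: "idist (w + u) (w + v) = idist u v"
    by (simp add: idist_def)
  show ?thesis
  proof (cases "idist u v \<ge> 2")
    case True
    have "kernel_mass (cell (w + u)) (cell (w + v)) = kernel_mass (cell u) (cell v)"
      using kernel_mass_affine[of "cell (w + u)" "cell (w + v)" 1 "lattice_point w"]
      by (simp only: cell_translate) simp
    with True idist show ?thesis
      by (simp add: pair_prob_far kernel_weight_def)
  next
    case False
    then have "idist u v = 1"
      using assms idist_eq_0_iff[of u v] by linarith
    with idist show ?thesis
      by (simp add: pair_prob_adjacent)
  qed
qed

lemma mean_dist_translate_le:
  fixes A :: "(int ^ 'd::finite) set"
  assumes fin: "finite A" and \<beta>: "\<beta> \<ge> 0"
  shows "mean_dist \<beta> ((+) w ` A) (w + u) (w + v) \<le> mean_dist \<beta> A u v"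
proof -
  let ?B = "(+) w ` A"
  let ?\<phi> = "\<lambda>e. (+) (- w) ` e"
  let ?G = "\<lambda>\<omega> e'. e' \<in> edges_in A \<and> (\<exists>e\<in>edges_in ?B. ?\<phi> e = e' \<and> \<omega> e)"
  have img: "?\<phi> e = e' \<longleftrightarrow> e = (+) w ` e'" for e e' :: "(int ^ 'd) set"
    by (auto simp: image_image)
  have law: "map_pmf ?G (box_pmf \<beta> ?B) = box_pmf \<beta> A"
  proof (rule map_fibre_box_pmf)
    fix e'
    assume "e' \<in> edges_in A"
    then obtain x y where xy: "e' = {x, y}" "x \<in> A" "y \<in> A" "x \<noteq> y"
      by (rule edges_inE)
    then have "(+) w ` e' = {w + x, w + y}" "{w + x, w + y} \<in> edges_in ?B"
      by (simp_all add: edges_in_iff)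
    then have "{e. e \<in> edges_in ?B \<and> ?\<phi> e = e'} = {{w + x, w + y}}"
      unfolding img by auto
    then show "1 - (\<Prod>e | e \<in> edges_in ?B \<and> ?\<phi> e = e'. 1 - edge_prob \<beta> e) = edge_prob \<beta> e'"
      using xy by (simp add: edge_prob_eq pair_prob_translate)
  qed (use fin \<beta> in auto)
  have "mean_dist \<beta> ?B (w + u) (w + v)
      \<le> (\<integral>\<^sup>+ \<omega>. ennreal_of_enat (graph_dist (?G \<omega>) A u v) \<partial>box_pmf \<beta> ?B)"
    unfolding mean_dist_def
  proof (intro nn_integral_mono)
    fix \<omega>
    have "graph_dist \<omega> ?B (w + u) (w + v) \<le> graph_dist (?G \<omega>) A u v"
      by (rule graph_dist_image_le) (unfold open_step_iff img, auto)
    then show "ennreal_of_enat (graph_dist \<omega> ?B (w + u) (w + v))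
        \<le> ennreal_of_enat (graph_dist (?G \<omega>) A u v)"
      by simp
  qed
  also have "\<dots> = mean_dist \<beta> A u v"
    unfolding mean_dist_def law[symmetric] by simp
  finally show ?thesis .
qed

subsection \<open>Renormalisation\<close>

definition block :: "nat \<Rightarrow> int ^ 'd \<Rightarrow> int ^ 'd" where
  "block m u = (\<chi> i. u $ i div int m)"

definition block_box :: "nat \<Rightarrow> int ^ 'd \<Rightarrow> (int ^ 'd) set" where
  "block_box m a = {u. block m u = a}"

lemma block_box_eq:
  assumes "m \<ge> 1"
  shows "block_box m a = (+) (\<chi> i. int m * a $ i) ` lattice_box m"
proof (intro set_eqI iffI)
  fix u
  assume "u \<in> block_box m a"
  then have "u = (\<chi> i. int m * a $ i) + (\<chi> i. u $ i mod int m)"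
    by (auto simp: block_box_def block_def vec_eq_iff) (metis mult_div_mod_eq)
  moreover have "(\<chi> i. u $ i mod int m) \<in> lattice_box m"
    using assms by (auto simp: lattice_box_def)
  ultimately show "u \<in> (+) (\<chi> i. int m * a $ i) ` lattice_box m"
    by blast
next
  fix u
  assume "u \<in> (+) (\<chi> i. int m * a $ i) ` lattice_box m"
  then show "u \<in> block_box m a"
    using assms by (auto simp: block_box_def block_def vec_eq_iff lattice_box_def)
qed

lemma finite_block_box [simp, intro]: "m \<ge> 1 \<Longrightarrow> finite (block_box m (a :: int ^ 'd::finite))"
  by (simp add: block_box_eq)

lemma block_in_box_iff:
  assumes "m \<ge> 1"
  shows "block m u \<in> lattice_box n \<longleftrightarrow> u \<in> lattice_box (m * n)"
proof -
  have "0 \<le> x div int m \<and> x div int m < int n \<longleftrightarrow> 0 \<le> x \<and> x < int (m * n)" for x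
  proof -
    have "int n \<le> x div int m \<longleftrightarrow> int n * int m \<le> x"
    proof
      assume "int n \<le> x div int m"
      then have "int n * int m \<le> (x div int m) * int m"
        by (rule mult_right_mono) simp
      also have "\<dots> \<le> x"
        using assms by (simp add: minus_mod_eq_div_mult[symmetric])
      finally show "int n * int m \<le> x" .
    next
      assume "int n * int m \<le> x"
      then have "int n * int m div int m \<le> x div int m"
        using assms by (intro zdiv_mono1) auto
      then show "int n \<le> x div int m"
        using assms by simp
    qed
    moreover have "0 \<le> x div int m \<longleftrightarrow> 0 \<le> x"
      using assms by (simp add: pos_imp_zdiv_nonneg_iff)
    ultimately show ?thesis
      by (auto simp: mult.commute not_le[symmetric])
  qed
  then show ?thesis
    by (simp add: lattice_box_def block_def)
qed

text \<open>The cell of \<open>a\<close>, enlarged by the factor \<open>m\<close>, is tiled by the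
  unit cells of its block: every point lies in exactly one unit cell, the one given by the floors of
  its coordinates. The \<open>0 +\<close> matches \<open>kernel_mass_affine\<close> at
  \<open>t = 0\<close>.\<close>

lemma indicator_block:
  fixes a :: "int ^ 'd::finite"
  assumes m: "m \<ge> 1"
  shows "indicator {x. 0 + (1 / real m) *\<^sub>R x \<in> cell a} x
    = (\<Sum>u\<in>block_box m a. indicator (cell u) x :: ennreal)"
proof -
  define f :: "int ^ 'd" where "f = (\<chi> i. \<lfloor>x $ i\<rfloor>)"
  have cell: "x \<in> cell u \<longleftrightarrow> f = u" for u
    by (auto simp: cell_iff f_def vec_eq_iff floor_eq_iff)
  have "0 + (1 / real m) *\<^sub>R x \<in> cell a \<longleftrightarrow> (\<forall>i. \<lfloor>x $ i / real_of_int (int m)\<rfloor> = a $ i)"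
    by (simp add: cell_iff floor_eq_iff)
  also have "\<dots> \<longleftrightarrow> f \<in> block_box m a"
    by (subst floor_divide_real_eq_div) (auto simp: block_box_def block_def f_def vec_eq_iff)
  finally have "indicator {x. 0 + (1 / real m) *\<^sub>R x \<in> cell a} x
      = (if f \<in> block_box m a then 1 else 0 :: ennreal)"
    by simp
  also have "\<dots> = (\<Sum>u\<in>block_box m a. if f = u then 1 else 0)"
    using m by (simp add: sum.delta)
  also have "\<dots> = (\<Sum>u\<in>block_box m a. indicator (cell u) x)"
    by (intro sum.cong refl) (simp add: cell indicator_def)
  finally show ?thesis .
qed

lemma idist_block_le_1:
  assumes m: "m \<ge> 1" and le: "idist u v \<le> m"
  shows "idist (block m u) (block m v) \<le> 1"
  unfolding idist_le_iff
proof
  fix i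
  have "\<bar>u $ i - v $ i\<bar> \<le> int m"
    using le by (simp add: idist_le_iff)
  then have "v $ i \<le> u $ i + int m" "u $ i \<le> v $ i + int m"
    by linarith+
  then have "v $ i div int m \<le> (u $ i + int m) div int m"
    and "u $ i div int m \<le> (v $ i + int m) div int m"
    using m by (blast intro: zdiv_mono1 of_nat_0_less_iff[THEN iffD2] less_le_trans[OF zero_less_one])+
  moreover have "(x + int m) div int m = x div int m + 1" for x
    using m by simp
  ultimately show "\<bar>block m u $ i - block m v $ i\<bar> \<le> int 1"
    unfolding block_def vec_lambda_beta abs_le_iff by simp
qed

lemma idist_block_ge:
  assumes m: "m \<ge> 1" and far: "idist (block m u) (block m v) \<ge> 2"
  shows "idist u v \<ge> 2"
  using idist_block_le_1[OF m, of u v] far m by linarith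

text \<open>Scale invariance followed by additivity. If the blocks do not touch, no two of their
  vertices do, so all masses are finite and the identity passes from \<open>ennreal\<close> to
  reals.\<close>

lemma kernel_weight_block:
  fixes a b :: "int ^ 'd::finite"
  assumes m: "m \<ge> 1" and far: "idist a b \<ge> 2"
  shows "kernel_weight a b = (\<Sum>u\<in>block_box m a. \<Sum>v\<in>block_box m b. kernel_weight u v)"
proof -
  have fars: "idist u v \<ge> 2" if "u \<in> block_box m a" "v \<in> block_box m b" for u v
    using idist_block_ge[OF m, of u v] far that by (simp add: block_box_def)
  have "kernel_mass (cell a) (cell b)
      = (\<Sum>u\<in>block_box m a. \<Sum>v\<in>block_box m b. kernel_mass (cell u) (cell v))"
  proof (subst kernel_mass_affine[where t = 0 and c = "1 / real m"])
    show "kernel_mass {x. 0 + (1 / real m) *\<^sub>R x \<in> cell a} {x. 0 + (1 / real m) *\<^sub>R x \<in> cell b}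
      = (\<Sum>u\<in>block_box m a. \<Sum>v\<in>block_box m b. kernel_mass (cell u) (cell v))"
      by (intro kernel_mass_sum finite_block_box indicator_block m cell_measurable)
  qed (use m in auto)
  also have "\<dots> = (\<Sum>u\<in>block_box m a. \<Sum>v\<in>block_box m b. ennreal (kernel_weight u v))"
    by (intro sum.cong refl ennreal_kernel_weight[symmetric] fars)
  also have "\<dots> = ennreal (\<Sum>u\<in>block_box m a. \<Sum>v\<in>block_box m b. kernel_weight u v)"
    by (simp add: sum_ennreal sum_nonneg)
  finally show ?thesis
    by (simp add: kernel_weight_def[of a b] sum_nonneg)
qed

text \<open>The exact renormalisation identity. For far blocks the closing probabilities are
  exponentials, whose product is the exponential of the summed weights. For adjacent blocks one
  factor of the product vanishes, in agreement with probability one.\<close>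

lemma edge_prob_block:
  fixes a b :: "int ^ 'd::finite"
  assumes m: "m \<ge> 1" and ab: "a \<noteq> b" "a \<in> lattice_box n" "b \<in> lattice_box n"
  shows "1 - (\<Prod>e | e \<in> edges_in (lattice_box (m * n)) \<and> block m ` e = {a, b}. 1 - edge_prob \<beta> e)
    = edge_prob \<beta> {a, b}"
proof -
  let ?J = "{e. e \<in> edges_in (lattice_box (m * n)) \<and> block m ` e = {a, b}}"
  let ?p = "\<lambda>(u, v). {u, v}"
  have inj: "inj_on ?p (block_box m a \<times> block_box m b)"
    using ab(1) by (auto simp: inj_on_def block_box_def doubleton_eq_iff)
  have J: "?J = ?p ` (block_box m a \<times> block_box m b)"
  proof (intro set_eqI iffI)
    fix e
    assume "e \<in> ?J"
    then obtain x y where "e = {x, y}" "{block m x, block m y} = {a, b}"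
      by (auto simp: edges_in_def)
    then show "e \<in> ?p ` (block_box m a \<times> block_box m b)"
      by (auto simp: doubleton_eq_iff block_box_def insert_commute)
  next
    fix e
    assume "e \<in> ?p ` (block_box m a \<times> block_box m b)"
    then obtain x y where xy: "e = {x, y}" "block m x = a" "block m y = b"
      by (auto simp: block_box_def)
    then have "x \<in> lattice_box (m * n)" "y \<in> lattice_box (m * n)" "x \<noteq> y"
      using ab block_in_box_iff[OF m] by metis+
    then show "e \<in> ?J"
      using xy by (simp add: edges_in_iff)
  qed
  have "(\<Prod>e\<in>?J. 1 - edge_prob \<beta> e)
      = (\<Prod>(u, v)\<in>block_box m a \<times> block_box m b. 1 - edge_prob \<beta> {u, v})"
    unfolding J using inj by (subst prod.reindex) (auto intro!: prod.cong)
  also have "\<dots> = (\<Prod>(u, v)\<in>block_box m a \<times> block_box m b. 1 - pair_prob \<beta> u v)"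
    using ab(1) by (intro prod.cong refl) (auto simp: block_box_def intro!: edge_prob_eq)
  also have "\<dots> = 1 - pair_prob \<beta> a b"
  proof (cases "idist a b \<ge> 2")
    case True
    have "(\<Prod>(u, v)\<in>block_box m a \<times> block_box m b. 1 - pair_prob \<beta> u v)
        = (\<Prod>(u, v)\<in>block_box m a \<times> block_box m b. exp (- \<beta> * kernel_weight u v))"
      using True by (intro prod.cong refl)
        (auto simp: block_box_def pair_prob_far idist_block_ge[OF m])
    also have "\<dots> = exp (- \<beta> * kernel_weight a b)"
    proof -
      have "- \<beta> * kernel_weight a b
          = (\<Sum>(u, v)\<in>block_box m a \<times> block_box m b. - \<beta> * kernel_weight u v)"
        unfolding kernel_weight_block[OF m True] sum.cartesian_product sum_distrib_left
        by (simp only: split_def)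
      then show ?thesis
        using m by (simp only: exp_sum finite_cartesian_product finite_block_box split_def)
    qed
    finally show ?thesis
      using True by (simp add: pair_prob_far)
  next
    case False
    then have adj: "idist a b = 1"
      using ab(1) idist_eq_0_iff[of a b] by linarith
    \<comment> \<open>Facing vertices of the two blocks: in a coordinate where the blocks differ,
      the lower block takes its last layer and the upper one its first; where they agree, both take
      the first layer.\<close>
    define u :: "int ^ 'd" where
      "u = (\<chi> i. if a $ i < b $ i then int m * a $ i + (int m - 1) else int m * a $ i)"
    define v :: "int ^ 'd" where
      "v = (\<chi> i. if b $ i < a $ i then int m * b $ i + (int m - 1) else int m * b $ i)"
    have u: "u \<in> block_box m a"
      using m by (auto simp: u_def block_box_def block_def vec_eq_iff)
    have v: "v \<in> block_box m b"
      using m by (auto simp: v_def block_box_def block_def vec_eq_iff)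
    have "idist u v \<le> 1"
      unfolding idist_le_iff
    proof
      fix i
      have "\<bar>a $ i - b $ i\<bar> \<le> 1"
        using idist_comp_le[of a i b] adj by simp
      then consider "b $ i = a $ i" | "b $ i = a $ i + 1" | "a $ i = b $ i + 1"
        by linarith
      then show "\<bar>u $ i - v $ i\<bar> \<le> int 1"
        using m by cases (auto simp: u_def v_def algebra_simps)
    qed
    moreover have "u \<noteq> v"
      using u v ab(1) by (auto simp: block_box_def)
    ultimately have "idist u v = 1"
      using idist_eq_0_iff[of u v] by linarith
    then have "pair_prob \<beta> u v = 1"
      by (rule pair_prob_adjacent)
    then have "(\<Prod>(u, v)\<in>block_box m a \<times> block_box m b. 1 - pair_prob \<beta> u v) = 0"
      using u v m by (intro prod_zero bexI[of _ "(u, v)"]) auto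
    then show ?thesis
      using adj by (simp add: pair_prob_adjacent)
  qed
  finally show ?thesis
    using ab(1) by (simp add: edge_prob_eq)
qed

text \<open>The restriction to edges of the small box makes the value \<open>False\<close>
  elsewhere, as in \<open>box_pmf\<close>, so that the laws are literally equal.\<close>

definition coarse :: "nat \<Rightarrow> nat \<Rightarrow> ((int ^ 'd) set \<Rightarrow> bool) \<Rightarrow> (int ^ 'd) set \<Rightarrow> bool" where
  "coarse m n \<omega> e' \<longleftrightarrow> e' \<in> edges_in (lattice_box n) \<and>
    (\<exists>e\<in>edges_in (lattice_box (m * n)). block m ` e = e' \<and> \<omega> e)"

lemma map_coarse_box_pmf:
  assumes "m \<ge> 1" "\<beta> \<ge> 0"
  shows "map_pmf (coarse m n) (box_pmf \<beta> (lattice_box (m * n) :: (int ^ 'd::finite) set))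
    = box_pmf \<beta> (lattice_box n)"
proof -
  have "(coarse m n :: _ \<Rightarrow> (int ^ 'd) set \<Rightarrow> bool) = (\<lambda>\<omega> e'. e' \<in> edges_in (lattice_box n) \<and>
      (\<exists>e\<in>edges_in (lattice_box (m * n)). block m ` e = e' \<and> \<omega> e))"
    by (simp add: coarse_def fun_eq_iff)
  moreover have "map_pmf (\<lambda>\<omega> e'. e' \<in> edges_in (lattice_box n) \<and>
      (\<exists>e\<in>edges_in (lattice_box (m * n)). block m ` e = e' \<and> \<omega> e))
      (box_pmf \<beta> (lattice_box (m * n) :: (int ^ 'd) set)) = box_pmf \<beta> (lattice_box n)"
  proof (rule map_fibre_box_pmf)
    fix e' :: "(int ^ 'd) set"
    assume "e' \<in> edges_in (lattice_box n)"
    then show "1 - (\<Prod>e | e \<in> edges_in (lattice_box (m * n)) \<and> block m ` e = e'. 1 - edge_prob \<beta> e)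
        = edge_prob \<beta> e'"
      by (rule edges_inE) (simp add: edge_prob_block[OF assms(1)])
  qed (use assms in auto)
  ultimately show ?thesis
    by simp
qed

subsection \<open>Mean distances\<close>

lemma mean_dist_antimono:
  assumes "finite A" "B \<subseteq> A"
  shows "mean_dist \<beta> A u v \<le> mean_dist \<beta> B u v"
proof -
  have "graph_dist \<omega> A u v \<le> graph_dist \<omega> B u v" for \<omega>
    using assms(2) by (intro graph_dist_mono) (auto simp: open_step_iff)
  then have "mean_dist \<beta> A u v \<le> (\<integral>\<^sup>+ \<omega>. ennreal_of_enat (graph_dist \<omega> B u v) \<partial>box_pmf \<beta> A)"
    unfolding mean_dist_def by (intro nn_integral_mono) simp
  also have "\<dots> = mean_dist \<beta> B u v"
    unfolding box_pmf_def using assms by (intro nn_integral_graph_dist_sub edges_in_mono) auto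
  finally show ?thesis .
qed

lemma mean_dist_triangle: "mean_dist \<beta> A u w \<le> mean_dist \<beta> A u v + mean_dist \<beta> A v w"
proof -
  have "mean_dist \<beta> A u w \<le> (\<integral>\<^sup>+ \<omega>. ennreal_of_enat (graph_dist \<omega> A u v)
      + ennreal_of_enat (graph_dist \<omega> A v w) \<partial>box_pmf \<beta> A)"
    unfolding mean_dist_def
    by (intro nn_integral_mono) (metis graph_dist_triangle ennreal_of_enat_le_iff ennreal_of_enat_plus)
  also have "\<dots> = mean_dist \<beta> A u v + mean_dist \<beta> A v w"
    unfolding mean_dist_def by (intro nn_integral_add) auto
  finally show ?thesis .
qed

lemma mean_dist_self [simp]: "mean_dist \<beta> A u u = 0"
  by (simp add: mean_dist_def)

text \<open>On the support of the finite law the nearest-neighbour edges are open without exception;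
  this replaces almost sure statements.\<close>

lemma adjacent_open:
  fixes A :: "(int ^ 'd::finite) set"
  assumes "finite A" "u \<in> A" "v \<in> A" "idist u v = 1" "\<omega> \<in> set_pmf (box_pmf \<beta> A)"
  shows "\<omega> {u, v}"
proof -
  have "u \<noteq> v"
    using assms(4) by auto
  then have e: "{u, v} \<in> edges_in A" "edge_prob \<beta> {u, v} = 1"
    using assms by (auto simp: edges_in_iff edge_prob_eq pair_prob_adjacent)
  have "\<omega> \<in> PiE_dflt (edges_in A) False (set_pmf \<circ> (\<lambda>e. bernoulli_pmf (edge_prob \<beta> e)))"
    using assms(1,5) unfolding box_pmf_def by (subst (asm) set_Pi_pmf) auto
  then have "\<omega> {u, v} \<in> set_pmf (bernoulli_pmf (edge_prob \<beta> {u, v}))"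
    using e(1) by (auto simp: PiE_dflt_def)
  then show ?thesis
    unfolding e(2) by (cases "\<omega> {u, v}") (auto simp: set_pmf_iff)
qed

text \<open>Diagonal neighbours have maximum-norm distance one, so a single step moves all
  coordinates of \<open>u\<close> towards \<open>v\<close> at once. Moving between two points of the
  box never leaves it.\<close>

lemma graph_dist_box_le_idist:
  fixes u v :: "int ^ 'd::finite"
  assumes \<omega>: "\<omega> \<in> set_pmf (box_pmf \<beta> (lattice_box n))"
    and uv: "u \<in> lattice_box n" "v \<in> lattice_box n" "idist u v \<le> j"
  shows "graph_dist \<omega> (lattice_box n) u v \<le> enat j"
  using uv
proof (induction j arbitrary: u)
  case 0
  then show ?case by simp
next
  case (Suc j)
  show ?case
  proof (cases "u = v")
    case True
    then show ?thesis by simp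
  next
    case False
    define z :: "int ^ 'd" where "z = (\<chi> i. u $ i + sgn (v $ i - u $ i))"
    have z: "z \<in> lattice_box n"
    proof -
      have "0 \<le> z $ i \<and> z $ i < int n" for i
      proof -
        have "0 \<le> u $ i" "u $ i < int n" "0 \<le> v $ i" "v $ i < int n"
          using Suc.prems(1,2) by (auto simp: lattice_box_def)
        then show ?thesis
          unfolding z_def vec_lambda_beta by (simp add: sgn_if)
      qed
      then show ?thesis
        by (simp add: lattice_box_def)
    qed
    have "idist u z \<le> 1"
      by (simp add: idist_le_iff z_def sgn_if)
    moreover have "u \<noteq> z"
    proof -
      obtain i where "u $ i \<noteq> v $ i"
        using False by (auto simp: vec_eq_iff)
      then have "u $ i \<noteq> z $ i"
        by (simp add: z_def sgn_if)
      then show ?thesis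
        by auto
    qed
    ultimately have uz: "u \<noteq> z" "idist u z = 1"
      using idist_eq_0_iff[of u z] by linarith+
    have "idist z v \<le> j"
      unfolding idist_le_iff
    proof
      fix i
      have "\<bar>u $ i - v $ i\<bar> \<le> int (Suc j)"
        using Suc.prems(3) by (simp add: idist_le_iff)
      then show "\<bar>z $ i - v $ i\<bar> \<le> int j"
        unfolding z_def vec_lambda_beta by (auto simp: sgn_if)
    qed
    then have zv: "graph_dist \<omega> (lattice_box n) z v \<le> enat j"
      by (rule Suc.IH[OF z Suc.prems(2)])
    have "\<omega> {u, z}"
      using Suc.prems(1) z uz(2) \<omega> by (rule adjacent_open[OF finite_lattice_box])
    then have "graph_dist \<omega> (lattice_box n) u z \<le> 1"
      using Suc.prems(1) z uz(1) by (intro graph_dist_open)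
    then have "graph_dist \<omega> (lattice_box n) u z + graph_dist \<omega> (lattice_box n) z v \<le> 1 + enat j"
      using zv by (rule add_mono)
    with graph_dist_triangle have "graph_dist \<omega> (lattice_box n) u v \<le> 1 + enat j"
      by (rule order_trans)
    then show ?thesis
      by (simp add: one_enat_def)
  qed
qed

text \<open>Jumps of at most \<open>N - 1\<close> in each coordinate lead from \<open>u\<close> to
  \<open>v\<close>. Every jump takes place inside a translate of the box of side \<open>N\<close>
  lying in the large box, where it costs at most \<open>c\<close> on average.\<close>

lemma mean_dist_chain:
  fixes u v :: "int ^ 'd::finite"
  assumes N: "2 \<le> N" "N \<le> n" and \<beta>: "\<beta> \<ge> 0"
    and c: "\<And>u v :: int ^ 'd. u \<in> lattice_box N \<Longrightarrow> v \<in> lattice_box N \<Longrightarrow>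
      mean_dist \<beta> (lattice_box N) u v \<le> c"
    and uv: "u \<in> lattice_box n" "v \<in> lattice_box n" "idist u v \<le> j * (N - 1)"
  shows "mean_dist \<beta> (lattice_box n) u v \<le> of_nat j * c"
  using uv
proof (induction j arbitrary: u)
  case (Suc j)
  define z :: "int ^ 'd" where
    "z = (\<chi> i. u $ i + max (- (int N - 1)) (min (int N - 1) (v $ i - u $ i)))"
  \<comment> \<open>The lower corner of a translate containing \<open>u\<close> and
    \<open>z\<close>; the cap \<open>int n - int N\<close> pushes it back inside the large
    box.\<close>
  define w :: "int ^ 'd" where
    "w = (\<chi> i. min (min (u $ i) (z $ i)) (int n - int N))"
  have z: "z \<in> lattice_box n"
  proof -
    have "0 \<le> z $ i \<and> z $ i < int n" for i
    proof -
      have "0 \<le> u $ i" "u $ i < int n" "0 \<le> v $ i" "v $ i < int n"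
        using Suc.prems(1,2) by (auto simp: lattice_box_def)
      then show ?thesis
        using N unfolding z_def vec_lambda_beta by (auto simp: max_def min_def)
    qed
    then show ?thesis
      by (simp add: lattice_box_def)
  qed
  have uz: "idist u z \<le> N - 1"
    using N by (auto simp: idist_le_iff z_def max_def min_def of_nat_diff)
  have zv: "idist z v \<le> j * (N - 1)"
    unfolding idist_le_iff
  proof
    fix i
    have eq: "int (j * (N - 1)) = int j * (int N - 1)"
      "int (Suc j * (N - 1)) = int j * (int N - 1) + (int N - 1)"
    proof -
      have "int (N - 1) = int N - 1"
        using N by simp
      then show "int (j * (N - 1)) = int j * (int N - 1)"
        "int (Suc j * (N - 1)) = int j * (int N - 1) + (int N - 1)"
        by (simp_all only: of_nat_mult of_nat_Suc distrib_right mult_1 add.commute)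
    qed
    have nonneg: "0 \<le> int j * (int N - 1)"
      using N by (intro mult_nonneg_nonneg) auto
    have "\<bar>u $ i - v $ i\<bar> \<le> int (Suc j * (N - 1))"
      using Suc.prems(3) by (simp add: idist_le_iff)
    then show "\<bar>z $ i - v $ i\<bar> \<le> int (j * (N - 1))"
      using nonneg N unfolding eq z_def vec_lambda_beta by (auto simp: max_def min_def)
  qed
  have w: "0 \<le> w $ i" "w $ i \<le> int n - int N" "w $ i \<le> u $ i" "w $ i \<le> z $ i"
    "u $ i < w $ i + int N" "z $ i < w $ i + int N" for i
  proof -
    have "0 \<le> u $ i" "u $ i < int n" "0 \<le> z $ i" "z $ i < int n" "\<bar>u $ i - z $ i\<bar> \<le> int (N - 1)"
      using Suc.prems(1) z uz by (auto simp: lattice_box_def idist_le_iff)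
    then show "0 \<le> w $ i" "w $ i \<le> int n - int N" "w $ i \<le> u $ i" "w $ i \<le> z $ i"
      "u $ i < w $ i + int N" "z $ i < w $ i + int N"
      using N unfolding w_def vec_lambda_beta by linarith+
  qed
  have in_N: "- w + u \<in> lattice_box N" "- w + z \<in> lattice_box N"
    using w unfolding lattice_box_def by (auto simp: algebra_simps)
  have sub: "(+) w ` lattice_box N \<subseteq> lattice_box n"
  proof
    fix x
    assume "x \<in> (+) w ` lattice_box N"
    then obtain y where y: "x = w + y" "y \<in> lattice_box N"
      by blast
    have "0 \<le> x $ i \<and> x $ i < int n" for i
      using y(2) w[of i] unfolding y(1) lattice_box_def by (auto dest!: spec[of _ i])
    then show "x \<in> lattice_box n"
      by (simp add: lattice_box_def)
  qed
  have "mean_dist \<beta> (lattice_box n) u z \<le> mean_dist \<beta> ((+) w ` lattice_box N) u z"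
    using sub by (intro mean_dist_antimono) auto
  also have "\<dots> \<le> mean_dist \<beta> (lattice_box N) (- w + u) (- w + z)"
    using mean_dist_translate_le[of "lattice_box N" \<beta> w "- w + u" "- w + z"] \<beta> by simp
  also have "\<dots> \<le> c"
    by (rule c[OF in_N])
  finally have "mean_dist \<beta> (lattice_box n) u z \<le> c" .
  then have "mean_dist \<beta> (lattice_box n) u z + mean_dist \<beta> (lattice_box n) z v \<le> c + of_nat j * c"
    using Suc.IH[OF z Suc.prems(2) zv] by (rule add_mono)
  also have "\<dots> = of_nat (Suc j) * c"
    by (simp add: algebra_simps)
  finally show ?case
    using mean_dist_triangle order_trans by blast
qed simp

lemma graph_dist_box_le:
  fixes u v :: "int ^ 'd::finite"
  assumes "\<omega> \<in> set_pmf (box_pmf \<beta> (lattice_box n))"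
    and "n \<ge> 1" "u \<in> lattice_box n" "v \<in> lattice_box n"
  shows "graph_dist \<omega> (lattice_box n) u v \<le> enat (n - 1)"
  using assms(1,3,4) idist_box_less[OF assms(3,4,2)] by (rule graph_dist_box_le_idist)

lemma mean_dist_box_le:
  fixes u v :: "int ^ 'd::finite"
  assumes "n \<ge> 1" "u \<in> lattice_box n" "v \<in> lattice_box n"
  shows "mean_dist \<beta> (lattice_box n) u v \<le> of_nat (n - 1)"
proof -
  have "mean_dist \<beta> (lattice_box n) u v \<le> (\<integral>\<^sup>+ \<omega>. of_nat (n - 1)
      \<partial>box_pmf \<beta> (lattice_box n :: (int ^ 'd) set))"
    unfolding mean_dist_def
  proof (intro nn_integral_mono_AE AE_pmfI)
    fix \<omega> :: "(int ^ 'd) set \<Rightarrow> bool"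
    assume "\<omega> \<in> set_pmf (box_pmf \<beta> (lattice_box n))"
    then show "ennreal_of_enat (graph_dist \<omega> (lattice_box n) u v) \<le> of_nat (n - 1)"
      using graph_dist_box_le[OF _ assms] by (metis ennreal_of_enat_enat ennreal_of_enat_le_iff)
  qed
  then show ?thesis
    by simp
qed

lemma finite_expected_dist_set:
  "finite {expected_dist \<beta> (lattice_box n) u v | u v :: int ^ 'd::finite.
    u \<in> lattice_box n \<and> v \<in> lattice_box n}"
proof -
  have "finite ((\<lambda>(u, v :: int ^ 'd). expected_dist \<beta> (lattice_box n) u v) `
      (lattice_box n \<times> lattice_box n))"
    by (intro finite_imageI finite_cartesian_product finite_lattice_box)
  then show ?thesis
    by (rule rev_finite_subset) force
qed

lemma lattice_box_zero: "n \<ge> 1 \<Longrightarrow> 0 \<in> lattice_box n"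
  by (simp add: lattice_box_def)

lemma expected_dist_le_Lambda:
  fixes u v :: "int ^ 'd::finite"
  assumes "u \<in> lattice_box n" "v \<in> lattice_box n"
  shows "expected_dist \<beta> (lattice_box n) u v \<le> Lambda TYPE('d) n \<beta> - 1"
proof -
  have "expected_dist \<beta> (lattice_box n) u v \<le> Max {expected_dist \<beta> (lattice_box n) u v |
      u v :: int ^ 'd. u \<in> lattice_box n \<and> v \<in> lattice_box n}"
    using assms by (intro Max_ge finite_expected_dist_set) blast
  then show ?thesis
    unfolding Lambda_def by linarith
qed

lemma mean_dist_le_Lambda:
  fixes u v :: "int ^ 'd::finite"
  assumes "n \<ge> 1" "u \<in> lattice_box n" "v \<in> lattice_box n"
  shows "mean_dist \<beta> (lattice_box n) u v \<le> ennreal (Lambda TYPE('d) n \<beta> - 1)"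
proof -
  have "mean_dist \<beta> (lattice_box n) u v < \<top>"
    using mean_dist_box_le[OF assms] by (rule le_less_trans) (simp add: of_nat_less_top)
  then have "mean_dist \<beta> (lattice_box n) u v = ennreal (expected_dist \<beta> (lattice_box n) u v)"
    by (simp add: expected_dist_eq)
  also have "\<dots> \<le> ennreal (Lambda TYPE('d) n \<beta> - 1)"
    using expected_dist_le_Lambda assms by (intro ennreal_leI)
  finally show ?thesis .
qed

lemma Lambda_leI:
  assumes n: "n \<ge> 1" and c: "c \<ge> 0"
    and le: "\<And>u v :: int ^ 'd::finite. u \<in> lattice_box n \<Longrightarrow> v \<in> lattice_box n \<Longrightarrow>
      mean_dist \<beta> (lattice_box n) u v \<le> ennreal c"
  shows "Lambda TYPE('d) n \<beta> \<le> c + 1"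
proof -
  let ?S = "{expected_dist \<beta> (lattice_box n) u v | u v :: int ^ 'd.
    u \<in> lattice_box n \<and> v \<in> lattice_box n}"
  have "finite ?S"
    by (rule finite_expected_dist_set)
  moreover have "?S \<noteq> {}"
    using lattice_box_zero[OF n] by blast
  moreover have "x \<le> c" if "x \<in> ?S" for x
  proof -
    obtain u v :: "int ^ 'd" where "x = expected_dist \<beta> (lattice_box n) u v"
      and uv: "u \<in> lattice_box n" "v \<in> lattice_box n"
      using \<open>x \<in> ?S\<close> by blast
    then have "x = enn2real (mean_dist \<beta> (lattice_box n) u v)"
      by (simp only: expected_dist_eq finite_lattice_box)
    then show ?thesis
      using c le[OF uv] by (simp only: enn2real_leI)
  qed
  ultimately have "Max ?S \<le> c"
    by (subst Max_le_iff) blast+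
  then show ?thesis
    unfolding Lambda_def by linarith
qed

lemma Lambda_ge_1: "n \<ge> 1 \<Longrightarrow> Lambda TYPE('d::finite) n \<beta> \<ge> 1"
  using expected_dist_le_Lambda[of "0 :: int ^ 'd" n 0 \<beta>] lattice_box_zero[of n]
  by (simp add: expected_dist_eq)

lemma Lambda_le:
  assumes "n \<ge> 1"
  shows "Lambda TYPE('d::finite) n \<beta> \<le> real n"
proof -
  have "Lambda TYPE('d) n \<beta> \<le> real (n - 1) + 1"
  proof (rule Lambda_leI)
    fix u v :: "int ^ 'd"
    assume "u \<in> lattice_box n" "v \<in> lattice_box n"
    then have "mean_dist \<beta> (lattice_box n) u v \<le> of_nat (n - 1)"
      by (rule mean_dist_box_le[OF assms])
    then show "mean_dist \<beta> (lattice_box n) u v \<le> ennreal (real (n - 1))"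
      by (simp only: ennreal_of_nat_eq_real_of_nat)
  qed (use assms in auto)
  then show ?thesis
    using assms by simp
qed

text \<open>Does the work of monotonicity when interpolating between powers of a fixed side. There
  are \<open>2 * m\<close> jumps because \<open>N \<ge> 2\<close> gives
  \<open>N \<le> 2 * (N - 1)\<close>.\<close>

lemma Lambda_le_smaller_box:
  assumes "\<beta> \<ge> 0" "2 \<le> N" "N \<le> n" "n \<le> m * N"
  shows "Lambda TYPE('d::finite) n \<beta> \<le> real (2 * m + 1) * Lambda TYPE('d) N \<beta>"
proof -
  let ?c = "Lambda TYPE('d) N \<beta> - 1"
  have c: "?c \<ge> 0"
    using Lambda_ge_1[of N] assms by auto
  have "mean_dist \<beta> (lattice_box n) u v \<le> ennreal (real (2 * m) * ?c)"
    if "u \<in> lattice_box n" "v \<in> lattice_box n" for u v :: "int ^ 'd"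
  proof -
    have "mean_dist \<beta> (lattice_box n) u v \<le> of_nat (2 * m) * ennreal ?c"
    proof (rule mean_dist_chain[where N = N])
      obtain k where k: "N = k + 2"
        using assms(2) by (metis add.commute le_Suc_ex)
      have "n - 1 \<le> 2 * m * (N - 1)"
        using assms(4) by (simp add: k algebra_simps)
      then show "idist u v \<le> 2 * m * (N - 1)"
        using idist_box_less[of u n v] that assms by linarith
    qed (use assms that in \<open>auto intro!: mean_dist_le_Lambda\<close>)
    also have "\<dots> = ennreal (real (2 * m) * ?c)"
      using c by (simp add: ennreal_of_nat_eq_real_of_nat ennreal_mult)
    finally show ?thesis .
  qed
  then have "Lambda TYPE('d) n \<beta> \<le> real (2 * m) * ?c + 1"
    using assms c by (intro Lambda_leI) auto
  also have "\<dots> \<le> real (2 * m + 1) * Lambda TYPE('d) N \<beta>"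
    using c by (simp add: algebra_simps)
  finally show ?thesis .
qed

subsection \<open>Submultiplicativity\<close>

text \<open>Conditionally on the edges between different blocks, a coarse path of length \<open>k\<close> is
  followed by crossing \<open>k + 1\<close> blocks, whose inner edges are independent of the conditioning.\<close>

lemma mean_dist_submultiplicative:
  fixes u v :: "int ^ 'd::finite"
  assumes m: "m \<ge> 1" and n: "n \<ge> 1" and \<beta>: "\<beta> \<ge> 0"
    and uv: "u \<in> lattice_box (m * n)" "v \<in> lattice_box (m * n)"
    and c: "\<And>u v :: int ^ 'd. u \<in> lattice_box m \<Longrightarrow> v \<in> lattice_box m \<Longrightarrow>
      mean_dist \<beta> (lattice_box m) u v \<le> c"
  shows "mean_dist \<beta> (lattice_box (m * n)) u v
    \<le> c + (c + 1) * mean_dist \<beta> (lattice_box n) (block m u) (block m v)"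
proof -
  let ?B = "\<lambda>e. bernoulli_pmf (edge_prob \<beta> e)"
  let ?V = "lattice_box (m * n) :: (int ^ 'd) set" and ?W = "lattice_box n :: (int ^ 'd) set"
  define I where "I = {e \<in> edges_in ?V. \<exists>a. block m ` e = {a}}"
  define J where "J = {e \<in> edges_in ?V. \<not> (\<exists>a. block m ` e = {a})}"
  define merge :: "((int ^ 'd) set \<Rightarrow> bool) \<Rightarrow> ((int ^ 'd) set \<Rightarrow> bool) \<Rightarrow> (int ^ 'd) set \<Rightarrow> bool"
    where "merge g f = (\<lambda>e. if e \<in> J then g e else f e)" for g f
  have IJ: "J \<union> I = edges_in ?V" "J \<inter> I = {}" and fin: "finite I" "finite J"
    by (auto simp: I_def J_def)
  have law: "box_pmf \<beta> ?V
      = map_pmf (\<lambda>(g, f). merge g f) (pair_pmf (Pi_pmf J False ?B) (Pi_pmf I False ?B))"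
    unfolding box_pmf_def IJ(1)[symmetric] merge_def using fin IJ(2) by (intro Pi_pmf_union)
  have coarse: "coarse m n (merge g f) = coarse m n g" for g f
  proof -
    have "e \<in> J" if "block m ` e \<in> edges_in ?W" "e \<in> edges_in ?V" for e
      using that by (auto simp: J_def elim!: edges_inE[of "block m ` e"] dest: singletonD)
    then show ?thesis
      by (auto simp: coarse_def merge_def fun_eq_iff)
  qed
  have inner: "(\<integral>\<^sup>+ f. ennreal_of_enat (graph_dist (merge g f) ?V x y) \<partial>Pi_pmf I False ?B) \<le> c"
    if x: "block m x \<in> ?W" and xy: "block m y = block m x" for g x y
  proof -
    let ?A = "block_box m (block m x)"
    let ?w = "(\<chi> i. int m * block m x $ i) :: int ^ 'd"
    have A: "?A \<subseteq> ?V"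
      using x unfolding block_box_def by (auto simp flip: block_in_box_iff[OF m])
    then have A_I: "edges_in ?A \<subseteq> I"
      by (auto simp: I_def block_box_def edges_in_def)
    have "graph_dist (merge g f) ?V x y \<le> graph_dist f ?A x y" for f
      using A A_I IJ(2) by (intro graph_dist_mono) (auto simp: open_step_iff merge_def edges_in_iff subset_iff)
    then have "(\<integral>\<^sup>+ f. ennreal_of_enat (graph_dist (merge g f) ?V x y) \<partial>Pi_pmf I False ?B)
        \<le> (\<integral>\<^sup>+ f. ennreal_of_enat (graph_dist f ?A x y) \<partial>Pi_pmf I False ?B)"
      by (intro nn_integral_mono) simp
    also have "\<dots> = mean_dist \<beta> ?A x y"
      using fin(1) A_I by (rule nn_integral_graph_dist_sub)
    also have "\<dots> \<le> mean_dist \<beta> (lattice_box m) (- ?w + x) (- ?w + y)"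
      using mean_dist_translate_le[of "lattice_box m" \<beta> ?w "- ?w + x" "- ?w + y"] \<beta>
      by (simp add: block_box_eq[OF m])
    also have "\<dots> \<le> c"
    proof (rule c)
      have shift: "- w + z \<in> B" if "z \<in> (+) w ` B" for w z :: "int ^ 'd" and B
        using that by auto
      have x: "x \<in> (+) ?w ` lattice_box m" and y: "y \<in> (+) ?w ` lattice_box m"
        unfolding block_box_eq[OF m, symmetric] using xy by (auto simp: block_box_def)
      show "- ?w + x \<in> lattice_box m"
        using x by (rule shift)
      show "- ?w + y \<in> lattice_box m"
        using y by (rule shift)
    qed
    finally show ?thesis .
  qed
  \<comment> \<open>There are \<open>k\<close> crossing edges and \<open>k + 1\<close> traversals
    with mean at most \<open>c\<close>. The vertices \<open>p\<close> and \<open>q\<close> depend on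
    \<open>g\<close> alone, so in the integral over \<open>f\<close> each traversal has fixed
    endpoints and \<open>inner\<close> applies.\<close>
  have path: "(\<integral>\<^sup>+ f. ennreal_of_enat (graph_dist (merge g f) ?V u y) \<partial>Pi_pmf I False ?B)
      \<le> c + (c + 1) * of_nat k"
    if "(block m u, block m y) \<in> open_step (coarse m n g) ?W ^^ k" for g y k
    using that
  proof (induction k arbitrary: y)
    case 0
    then have eq: "block m y = block m u"
      by simp
    have "block m u \<in> ?W"
      using uv(1) by (simp only: block_in_box_iff[OF m])
    from inner[OF this eq] show ?case
      by (simp only: of_nat_0 mult_zero_right add_0_right)
  next
    case (Suc k)
    then obtain b where b: "(block m u, b) \<in> open_step (coarse m n g) ?W ^^ k"
      "(b, block m y) \<in> open_step (coarse m n g) ?W"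
      by auto
    then have "coarse m n g {b, block m y}" and bW: "b \<in> ?W" and ne: "b \<noteq> block m y"
      and yW: "block m y \<in> ?W"
      by (auto simp: open_step_iff)
    then obtain e where e: "e \<in> edges_in ?V" "block m ` e = {b, block m y}" "g e"
      by (auto simp: coarse_def)
    then obtain p0 q0 where pq0: "e = {p0, q0}" "p0 \<noteq> q0" "p0 \<in> ?V" "q0 \<in> ?V"
      by (auto elim: edges_inE)
    with e(2) have "{block m p0, block m q0} = {b, block m y}"
      by simp
    then consider "block m p0 = b" "block m q0 = block m y" | "block m q0 = b" "block m p0 = block m y"
      by (auto simp: doubleton_eq_iff)
    then obtain p q where pq: "e = {p, q}" "p \<noteq> q" "p \<in> ?V" "q \<in> ?V"
      "block m p = b" "block m q = block m y"
      using pq0 by cases (auto simp: insert_commute)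
    have "e \<in> J"
      using e ne by (auto simp: J_def)
    then have "graph_dist (merge g f) ?V p q \<le> 1" for f
      using pq e by (intro graph_dist_open) (auto simp: merge_def)
    then have pq1: "graph_dist (merge g f) ?V u y
        \<le> graph_dist (merge g f) ?V u p + (1 + graph_dist (merge g f) ?V q y)" for f
      using graph_dist_triangle[of "merge g f" ?V u y p] graph_dist_triangle[of "merge g f" ?V p y q]
      by (meson add_left_mono add_right_mono order_trans)
    have "(\<integral>\<^sup>+ f. ennreal_of_enat (graph_dist (merge g f) ?V u y) \<partial>Pi_pmf I False ?B)
        \<le> (\<integral>\<^sup>+ f. ennreal_of_enat (graph_dist (merge g f) ?V u p)
          + (1 + ennreal_of_enat (graph_dist (merge g f) ?V q y)) \<partial>Pi_pmf I False ?B)"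
      using pq1 by (intro nn_integral_mono)
        (metis ennreal_of_enat_1 ennreal_of_enat_plus ennreal_of_enat_le_iff)
    also have "\<dots> = (\<integral>\<^sup>+ f. ennreal_of_enat (graph_dist (merge g f) ?V u p) \<partial>Pi_pmf I False ?B)
        + (1 + (\<integral>\<^sup>+ f. ennreal_of_enat (graph_dist (merge g f) ?V q y) \<partial>Pi_pmf I False ?B))"
      by (simp add: nn_integral_add)
    also have "\<dots> \<le> (c + (c + 1) * of_nat k) + (1 + c)"
      using Suc.IH[of p] b(1) pq yW by (intro add_mono inner order_refl) auto
    also have "\<dots> = c + (c + 1) * of_nat (Suc k)"
      by (simp add: algebra_simps)
    finally show ?case .
  qed
  \<comment> \<open>The coarse distance is a function of \<open>g\<close>, but is written in terms
    of \<open>merge g f\<close> so that both integrals can be folded back into one over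
    \<open>box_pmf\<close>.\<close>
  have step: "(\<integral>\<^sup>+ f. ennreal_of_enat (graph_dist (merge g f) ?V u v) \<partial>Pi_pmf I False ?B)
      \<le> (\<integral>\<^sup>+ f. c + (c + 1) * ennreal_of_enat (graph_dist (coarse m n (merge g f)) ?W (block m u) (block m v))
          \<partial>Pi_pmf I False ?B)" for g
  proof (cases "graph_dist (coarse m n g) ?W (block m u) (block m v) = \<infinity>")
    case True
    then show ?thesis
      by (simp add: coarse ennreal_mult_top)
  next
    case False
    then obtain k where k: "graph_dist (coarse m n g) ?W (block m u) (block m v) = enat k"
      "(block m u, block m v) \<in> open_step (coarse m n g) ?W ^^ k"
      using graph_dist_attained by meson
    show ?thesis
      using path[OF k(2)] k(1) by (simp add: coarse)
  qed
  have "mean_dist \<beta> ?V u v = (\<integral>\<^sup>+ g. \<integral>\<^sup>+ f. ennreal_of_enat (graph_dist (merge g f) ?V u v)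
      \<partial>Pi_pmf I False ?B \<partial>Pi_pmf J False ?B)"
    unfolding mean_dist_def law by (simp add: nn_integral_pair_pmf' split_def)
  also have "\<dots> \<le> (\<integral>\<^sup>+ g. \<integral>\<^sup>+ f. c + (c + 1) * ennreal_of_enat
        (graph_dist (coarse m n (merge g f)) ?W (block m u) (block m v))
      \<partial>Pi_pmf I False ?B \<partial>Pi_pmf J False ?B)"
    by (intro nn_integral_mono step)
  also have "\<dots> = (\<integral>\<^sup>+ \<omega>. c + (c + 1) * ennreal_of_enat
        (graph_dist (coarse m n \<omega>) ?W (block m u) (block m v)) \<partial>box_pmf \<beta> ?V)"
    unfolding law by (simp add: nn_integral_pair_pmf' split_def)
  also have "\<dots> = c + (c + 1) * (\<integral>\<^sup>+ \<omega>. ennreal_of_enat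
        (graph_dist (coarse m n \<omega>) ?W (block m u) (block m v)) \<partial>box_pmf \<beta> ?V)"
    by (simp add: nn_integral_add nn_integral_cmult)
  also have "(\<integral>\<^sup>+ \<omega>. ennreal_of_enat (graph_dist (coarse m n \<omega>) ?W (block m u) (block m v))
      \<partial>box_pmf \<beta> ?V) = mean_dist \<beta> ?W (block m u) (block m v)"
    unfolding mean_dist_def map_coarse_box_pmf[OF m \<beta>, of n, symmetric] by simp
  finally show ?thesis .
qed

text \<open>With \<open>a\<close> and \<open>b\<close> the two values of \<open>Lambda\<close>, the
  preceding bound reads \<open>(a - 1) + a * (b - 1) = a * b - 1\<close>. The \<open>+ 1\<close> in
  \<open>Lambda\<close> thus absorbs the crossing edges.\<close>

lemma Lambda_submultiplicative:
  assumes m: "m \<ge> 1" and n: "n \<ge> 1" and \<beta>: "\<beta> \<ge> 0"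
  shows "Lambda TYPE('d::finite) (m * n) \<beta> \<le> Lambda TYPE('d) m \<beta> * Lambda TYPE('d) n \<beta>"
proof -
  let ?a = "Lambda TYPE('d) m \<beta>" and ?b = "Lambda TYPE('d) n \<beta>"
  have ab: "?a \<ge> 1" "?b \<ge> 1"
    using Lambda_ge_1 m n by auto
  have "Lambda TYPE('d) (m * n) \<beta> \<le> (?a * ?b - 1) + 1"
  proof (rule Lambda_leI)
    fix u v :: "int ^ 'd"
    assume uv: "u \<in> lattice_box (m * n)" "v \<in> lattice_box (m * n)"
    have "mean_dist \<beta> (lattice_box (m * n)) u v \<le> ennreal (?a - 1)
        + (ennreal (?a - 1) + 1) * mean_dist \<beta> (lattice_box n) (block m u) (block m v)"
      using uv m n \<beta> by (intro mean_dist_submultiplicative mean_dist_le_Lambda) auto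
    also have "\<dots> \<le> ennreal (?a - 1) + (ennreal (?a - 1) + 1) * ennreal (?b - 1)"
      using uv m n \<beta> by (intro add_left_mono mult_left_mono mean_dist_le_Lambda)
        (auto simp: block_in_box_iff)
    also have "\<dots> = ennreal ((?a - 1) + (?a - 1 + 1) * (?b - 1))"
    proof -
      have "ennreal (?a - 1) + 1 = ennreal (?a - 1 + 1)"
        using ab by (subst ennreal_plus) auto
      then show ?thesis
        using ab by (simp add: ennreal_mult)
    qed
    also have "(?a - 1) + (?a - 1 + 1) * (?b - 1) = ?a * ?b - 1"
      by (simp add: algebra_simps)
    finally show "mean_dist \<beta> (lattice_box (m * n)) u v \<le> ennreal (?a * ?b - 1)" .
  next
    show "1 \<le> m * n"
      using m n by simp
    show "0 \<le> ?a * ?b - 1"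
      using mult_mono[OF ab] ab by simp
  qed
  then show ?thesis
    by simp
qed

subsection \<open>Existence of the exponent\<close>

text \<open>Fekete's argument on a logarithmic scale. For \<open>n\<close> between
  \<open>m ^ k\<close> and \<open>m ^ (k + 1)\<close>, \<open>reg\<close> compares
  \<open>f n\<close> with \<open>f (m ^ k)\<close> up to a factor independent of \<open>n\<close>,
  which disappears after division by \<open>ln n\<close>. The limit is the infimum of the ratios,
  hence at most each of them.\<close>

lemma submultiplicative_exponent:
  fixes f :: "nat \<Rightarrow> real"
  assumes ge_1: "\<And>n. n \<ge> 1 \<Longrightarrow> f n \<ge> 1"
    and sub: "\<And>m n. m \<ge> 1 \<Longrightarrow> n \<ge> 1 \<Longrightarrow> f (m * n) \<le> f m * f n"
    and reg: "\<And>m N n. 2 \<le> N \<Longrightarrow> N \<le> n \<Longrightarrow> n \<le> m * N \<Longrightarrow> f n \<le> real (2 * m + 1) * f N"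
  shows "convergent (\<lambda>n. ln (f n) / ln (real n))"
    and "m \<ge> 2 \<Longrightarrow> lim (\<lambda>n. ln (f n) / ln (real n)) \<le> ln (f m) / ln (real m)"
proof -
  define a where "a n = ln (f n) / ln (real n)" for n
  have a_nonneg: "0 \<le> a n" if "n \<ge> 1" for n
    using ge_1[OF that] that by (simp add: a_def)
  have bdd: "bdd_below (a ` {2..})"
    by (rule bdd_belowI[of _ 0]) (auto intro!: a_nonneg)
  have main: "a n \<le> ln (real (2 * m + 1)) / ln (real n) + a m" if m: "m \<ge> 2" and n: "n \<ge> m" for m n
  proof -
    obtain k where k: "m ^ k \<le> n" "n < m ^ (k + 1)"
      using ex_power_ivl1[of m n] m n by auto
    have "k \<noteq> 0"
      using k(2) n by (intro notI) simp
    then have mk: "2 \<le> m ^ k"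
      using m self_le_power[of m k] by linarith
    have pos: "f m \<ge> 1" "f n \<ge> 1" "f (m ^ k) \<ge> 1"
      using ge_1 m n mk by auto
    have pow: "f (m ^ Suc j) \<le> f m ^ Suc j" for j
    proof (induction j)
      case (Suc j)
      have "f (m ^ Suc (Suc j)) \<le> f m * f (m ^ Suc j)"
        using sub[of m "m ^ Suc j"] m by simp
      also have "\<dots> \<le> f m * f m ^ Suc j"
        using Suc pos(1) by (intro mult_left_mono) auto
      finally show ?case by simp
    qed simp
    have "f n \<le> real (2 * m + 1) * f (m ^ k)"
      using reg[of "m ^ k" n m] mk k by simp
    also have "\<dots> \<le> real (2 * m + 1) * f m ^ k"
      using pow[of "k - 1"] \<open>k \<noteq> 0\<close> by (intro mult_left_mono) auto
    finally have "ln (f n) \<le> ln (real (2 * m + 1) * f m ^ k)"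
      using pos by (subst ln_le_cancel_iff) (auto intro!: mult_pos_pos)
    also have "\<dots> = ln (real (2 * m + 1)) + real k * ln (f m)"
      using pos by (subst ln_mult) (auto simp: ln_realpow)
    finally have 1: "ln (f n) \<le> ln (real (2 * m + 1)) + real k * ln (f m)" .
    have "real k * ln (real m) = ln (real (m ^ k))"
      using m by (simp add: ln_realpow)
    also have "\<dots> \<le> ln (real n)"
      using k(1) mk m by (subst ln_le_cancel_iff) (auto simp del: of_nat_power)
    finally have "real k \<le> ln (real n) / ln (real m)"
      using m by (simp add: field_simps)
    then have "real k * ln (f m) \<le> ln (real n) / ln (real m) * ln (f m)"
      using pos by (intro mult_right_mono) auto
    with 1 have "ln (f n) \<le> ln (real (2 * m + 1)) + ln (real n) * a m"
      by (simp add: a_def)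
    then show ?thesis
      using m n by (simp add: a_def field_simps)
  qed
  define L where "L = Inf (a ` {2..})"
  have L_le: "L \<le> a n" if "n \<ge> 2" for n
    unfolding L_def using that by (intro cInf_lower bdd) auto
  have lim: "a \<longlonglongrightarrow> L"
  proof (rule order_tendstoI)
    fix x
    assume "x < L"
    then show "eventually (\<lambda>n. x < a n) sequentially"
      using L_le by (intro eventually_sequentiallyI[of 2]) (meson less_le_trans)
  next
    fix x
    assume "L < x"
    then obtain m where m: "m \<ge> 2" "a m < x"
      unfolding L_def by (subst (asm) cInf_less_iff) (auto intro: bdd)
    have "(\<lambda>n. ln (real (2 * m + 1)) / ln (real n)) \<longlonglongrightarrow> 0"
      by real_asymp
    then have "eventually (\<lambda>n. ln (real (2 * m + 1)) / ln (real n) < x - a m) sequentially"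
      using m(2) by (intro order_tendstoD) auto
    then show "eventually (\<lambda>n. a n < x) sequentially"
      using eventually_ge_at_top[of m]
    proof eventually_elim
      case (elim n)
      then show ?case
        using main[OF m(1), of n] by linarith
    qed
  qed
  then show "convergent (\<lambda>n. ln (f n) / ln (real n))"
    unfolding a_def convergent_def by blast
  show "lim (\<lambda>n. ln (f n) / ln (real n)) \<le> ln (f m) / ln (real m)" if "m \<ge> 2"
  proof -
    have "(\<lambda>n. ln (f n) / ln (real n)) = a"
      by (simp add: a_def fun_eq_iff)
    then show ?thesis
      using limI[OF lim] L_le[OF that] by (simp add: a_def[of m])
  qed
qed

lemma
  assumes "\<beta> \<ge> 0"
  shows convergent_Lambda_exponent:
      "convergent (\<lambda>n. ln (Lambda TYPE('d::finite) n \<beta>) / ln (real n))"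
    and distance_exponent_le:
      "m \<ge> 2 \<Longrightarrow> distance_exponent TYPE('d) \<beta> \<le> ln (Lambda TYPE('d) m \<beta>) / ln (real m)"
proof -
  let ?f = "\<lambda>n. Lambda TYPE('d) n \<beta>"
  show "convergent (\<lambda>n. ln (?f n) / ln (real n))"
    by (intro submultiplicative_exponent(1)[where f = ?f] Lambda_ge_1 Lambda_submultiplicative
        Lambda_le_smaller_box assms)
  show "distance_exponent TYPE('d) \<beta> \<le> ln (?f m) / ln (real m)" if "m \<ge> 2"
    unfolding distance_exponent_def
    by (intro submultiplicative_exponent(2)[where f = ?f] Lambda_ge_1 Lambda_submultiplicative
        Lambda_le_smaller_box assms that)
qed

subsection \<open>The upper bound\<close>

lemma prob_edge_closed:
  assumes "finite A" "\<beta> \<ge> 0" "u \<in> A" "v \<in> A" "u \<noteq> v"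
  shows "measure_pmf.prob (box_pmf \<beta> A) {\<omega>. \<not> \<omega> {u, v}} = 1 - pair_prob \<beta> u v"
proof -
  have "measure_pmf.prob (box_pmf \<beta> A) {\<omega>. \<not> \<omega> {u, v}}
      = measure_pmf.prob (map_pmf (\<lambda>\<omega>. \<omega> {u, v}) (box_pmf \<beta> A)) {False}"
    by (simp add: vimage_def)
  also have "map_pmf (\<lambda>\<omega>. \<omega> {u, v}) (box_pmf \<beta> A) = bernoulli_pmf (pair_prob \<beta> u v)"
    unfolding box_pmf_def using assms
    by (subst Pi_pmf_component) (auto simp: edges_in_iff edge_prob_eq)
  also have "measure_pmf.prob \<dots> {False} = 1 - pair_prob \<beta> u v"
    using pair_prob_bounds[of \<beta> u v] assms by (simp add: measure_pmf_single)
  finally show ?thesis .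
qed

text \<open>All weights in the box are at least \<open>1 / (d * n) ^ (2 * d)\<close>. The crude
  estimate \<open>exp (- x) \<le> 1 / x\<close> is sufficient, since the error only has to beat a
  factor \<open>n\<close>.\<close>

lemma one_minus_pair_prob_le:
  fixes u v :: "int ^ 'd::finite"
  assumes "\<beta> > 0" "n \<ge> 1" "u \<in> lattice_box n" "v \<in> lattice_box n" "u \<noteq> v"
  shows "1 - pair_prob \<beta> u v \<le> (real CARD('d) * real n) ^ (2 * CARD('d)) / \<beta>"
proof (cases "idist u v \<ge> 2")
  case True
  define R where "R = (real CARD('d) * real n) ^ (2 * CARD('d))"
  have R: "R > 0"
    using assms by (simp add: R_def)
  have "real (idist u v) + 1 \<le> real n"
    using idist_box_less[of u n v] assms by linarith
  then have "(real CARD('d) * (real (idist u v) + 1)) ^ (2 * CARD('d)) \<le> R"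
    unfolding R_def by (intro power_mono mult_left_mono) auto
  then have "1 / R \<le> 1 / (real CARD('d) * (real (idist u v) + 1)) ^ (2 * CARD('d))"
    using R by (intro divide_left_mono mult_pos_pos zero_less_power) (auto simp: add_pos_pos)
  also have "\<dots> \<le> kernel_weight u v"
    by (rule kernel_weight_ge[OF True])
  finally have "\<beta> / R \<le> \<beta> * kernel_weight u v"
    using assms(1) mult_left_mono[of "1 / R" "kernel_weight u v" \<beta>] by simp
  then have "1 - pair_prob \<beta> u v \<le> exp (- (\<beta> / R))"
    by (simp add: pair_prob_far[OF True])
  also have "\<dots> = 1 / exp (\<beta> / R)"
    by (simp add: exp_minus field_simps)
  also have "\<dots> \<le> 1 / (\<beta> / R)"
  proof (intro divide_left_mono mult_pos_pos)
    show "\<beta> / R \<le> exp (\<beta> / R)"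
      using exp_ge_add_one_self[of "\<beta> / R"] by linarith
  qed (use assms(1) R in auto)
  finally show ?thesis
    by (simp add: R_def)
next
  case False
  then have "idist u v = 1"
    using assms idist_eq_0_iff[of u v] by linarith
  then show ?thesis
    using assms by (simp add: pair_prob_adjacent)
qed

text \<open>If the direct edge is open the distance is at most 1; otherwise a nearest-neighbour path
  costs less than \<open>n\<close>. Of the exponent \<open>2 * d + 1\<close>, the part
  \<open>2 * d\<close> pays for the closing probability and the remaining 1 for the length of that
  path.\<close>

lemma Lambda_bounded:
  fixes \<beta> :: real
  assumes \<beta>: "\<beta> > 0" and n: "n \<ge> 1" "real n ^ (2 * CARD('d::finite) + 1) \<le> \<beta>"
  shows "Lambda TYPE('d) n \<beta> \<le> 2 + real CARD('d) ^ (2 * CARD('d))"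
proof -
  let ?d = "CARD('d)"
  let ?V = "lattice_box n :: (int ^ 'd) set"
  have "Lambda TYPE('d) n \<beta> \<le> (1 + real ?d ^ (2 * ?d)) + 1"
  proof (rule Lambda_leI)
    fix u v :: "int ^ 'd"
    assume uv: "u \<in> ?V" "v \<in> ?V"
    show "mean_dist \<beta> ?V u v \<le> ennreal (1 + real ?d ^ (2 * ?d))"
    proof (cases "u = v")
      case False
      let ?A = "{\<omega>. \<not> \<omega> {u, v}}"
      have "mean_dist \<beta> ?V u v \<le> (\<integral>\<^sup>+ \<omega>. 1 + of_nat n * indicator ?A \<omega> \<partial>box_pmf \<beta> ?V)"
        unfolding mean_dist_def
      proof (intro nn_integral_mono_AE AE_pmfI)
        fix \<omega> :: "(int ^ 'd) set \<Rightarrow> bool"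
        assume \<omega>: "\<omega> \<in> set_pmf (box_pmf \<beta> ?V)"
        show "ennreal_of_enat (graph_dist \<omega> ?V u v) \<le> 1 + of_nat n * indicator ?A \<omega>"
        proof (cases "\<omega> {u, v}")
          case True
          then have "graph_dist \<omega> ?V u v \<le> 1"
            using uv False by (intro graph_dist_open)
          then have "ennreal_of_enat (graph_dist \<omega> ?V u v) \<le> 1"
            by (metis ennreal_of_enat_le_iff ennreal_of_enat_1)
          then show ?thesis
            using True by simp
        next
          case closed: False
          have "graph_dist \<omega> ?V u v \<le> enat (n - 1)"
            using \<omega> n(1) uv by (rule graph_dist_box_le)
          then have "ennreal_of_enat (graph_dist \<omega> ?V u v) \<le> of_nat (n - 1)"
            by (metis ennreal_of_enat_le_iff ennreal_of_enat_enat)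
          also have "\<dots> \<le> 1 + of_nat n"
            by (simp add: add_increasing of_nat_mono)
          finally show ?thesis
            using closed by simp
        qed
      qed
      also have "\<dots> = 1 + of_nat n * emeasure (box_pmf \<beta> ?V) ?A"
        by (simp add: nn_integral_add nn_integral_cmult)
      also have "emeasure (box_pmf \<beta> ?V) ?A = ennreal (1 - pair_prob \<beta> u v)"
        using prob_edge_closed[of ?V \<beta> u v] \<beta> uv False
        by (simp add: measure_pmf.emeasure_eq_measure)
      also have "1 + of_nat n * \<dots> = ennreal (1 + real n * (1 - pair_prob \<beta> u v))"
        using pair_prob_bounds[of \<beta> u v] \<beta> False
        by (simp add: ennreal_of_nat_eq_real_of_nat ennreal_mult)
      also have "\<dots> \<le> ennreal (1 + real ?d ^ (2 * ?d))"
      proof (intro ennreal_leI add_left_mono)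
        have "real n * (1 - pair_prob \<beta> u v) \<le> real n * ((real ?d * real n) ^ (2 * ?d) / \<beta>)"
          using one_minus_pair_prob_le[of \<beta> n u v] \<beta> n uv False by (intro mult_left_mono) auto
        also have "\<dots> = real ?d ^ (2 * ?d) * (real n ^ (2 * ?d + 1) / \<beta>)"
          by (simp add: power_mult_distrib)
        also have "\<dots> \<le> real ?d ^ (2 * ?d) * 1"
          using n \<beta> by (intro mult_left_mono) auto
        finally show "real n * (1 - pair_prob \<beta> u v) \<le> real ?d ^ (2 * ?d)"
          by simp
      qed
      finally show ?thesis .
    qed simp
  qed (use n in auto)
  then show ?thesis
    by simp
qed

text \<open>Takes the largest side allowed by \<open>Lambda_bounded\<close>, about
  \<open>\<beta> powr (1 / q)\<close>, so that a bounded numerator stands over a logarithm of order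
  \<open>ln \<beta>\<close>.\<close>

lemma distance_exponent_upper:
  "\<exists>C>0. \<forall>\<beta>\<ge>2. distance_exponent TYPE('d::finite) \<beta> \<le> C / ln \<beta>"
proof -
  let ?d = "CARD('d)"
  define q where "q = 2 * ?d + 1"
  define K where "K = 2 + real ?d ^ (2 * ?d)"
  have K: "K \<ge> 2"
    by (simp add: K_def)
  have q: "q \<ge> 1"
    by (simp add: q_def)
  have "distance_exponent TYPE('d) \<beta> \<le> (2 * q * ln K) / ln \<beta>" if \<beta>: "\<beta> \<ge> 2" for \<beta>
  proof (cases "2 ^ q \<le> \<beta>")
    case True
    define r where "r = \<beta> powr (1 / q)"
    have r_pow: "r ^ q = \<beta>"
      unfolding r_def using \<beta> q by (simp add: powr_power)
    have r: "r \<ge> 2"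
    proof (rule ccontr)
      assume "\<not> r \<ge> 2"
      then have "r ^ q < 2 ^ q"
        using q by (intro power_strict_mono) (auto simp: r_def)
      then show False
        using r_pow True by simp
    qed
    define n where "n = nat \<lfloor>r\<rfloor>"
    have n: "n \<ge> 2" "real n \<le> r" "r < real n + 1"
      using r by (auto simp: n_def le_nat_iff le_floor_iff of_nat_nat)
    have "real n ^ q \<le> r ^ q"
      using n by (intro power_mono) auto
    then have "Lambda TYPE('d) n \<beta> \<le> K"
      unfolding K_def using Lambda_bounded[of \<beta> n, where 'd = 'd] n \<beta> r_pow by (simp add: q_def)
    moreover have "Lambda TYPE('d) n \<beta> \<ge> 1"
      using n by (intro Lambda_ge_1) auto
    ultimately have "ln (Lambda TYPE('d) n \<beta>) \<le> ln K"
      by simp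
    moreover have "distance_exponent TYPE('d) \<beta> \<le> ln (Lambda TYPE('d) n \<beta>) / ln (real n)"
      using \<beta> n by (intro distance_exponent_le) auto
    ultimately have 1: "distance_exponent TYPE('d) \<beta> \<le> ln K / ln (real n)"
      using n by (smt (verit, best) divide_right_mono ln_ge_zero of_nat_1 of_nat_mono one_le_numeral order_trans of_nat_numeral)
    \<comment> \<open>Undoes the floor: \<open>r < n + 1\<close> is at most \<open>n ^ 2\<close> for
      \<open>n \<ge> 2\<close>. This is the factor 2 in the constant.\<close>
    have "r \<le> real n ^ 2"
    proof -
      have "real n * 2 \<le> real n * real n"
        using n by (intro mult_left_mono) auto
      then show ?thesis
        using n unfolding power2_eq_square by linarith
    qed
    then have "ln r \<le> ln (real n ^ 2)"
      using r n by (subst ln_le_cancel_iff) auto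
    also have "\<dots> = 2 * ln (real n)"
      using n by (simp add: ln_realpow)
    finally have "ln \<beta> \<le> 2 * q * ln (real n)"
      using r_pow r q by (auto simp: ln_realpow algebra_simps)
    then have "ln K * ln \<beta> \<le> ln K * (2 * q * ln (real n))"
      using K by (intro mult_left_mono) auto
    then have "ln K / ln (real n) \<le> 2 * q * ln K / ln \<beta>"
      using n \<beta> by (simp add: divide_simps mult_ac)
    with 1 show ?thesis
      by linarith
  next
    case False
    \<comment> \<open>The side would fall below 2 here. As \<open>ln \<beta>\<close> is bounded on
      this range, the trivial bound 1 for the exponent, read off at side 2, is enough.\<close>
    have "ln (Lambda TYPE('d) 2 \<beta>) \<le> ln 2"
      using Lambda_le[of 2, where 'd = 'd] Lambda_ge_1[of 2, where 'd = 'd]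
      by (subst ln_le_cancel_iff) (auto intro: less_le_trans[OF zero_less_one])
    then have "distance_exponent TYPE('d) \<beta> \<le> 1"
      using distance_exponent_le[of \<beta> 2, where 'd = 'd] \<beta> by (simp add: order_trans)
    also have "1 \<le> 2 * q * ln K / ln \<beta>"
    proof -
      have "ln \<beta> \<le> ln (2 ^ q)"
        using False \<beta> by (subst ln_le_cancel_iff) auto
      also have "\<dots> = q * ln 2"
        by (simp add: ln_realpow)
      also have "\<dots> \<le> q * ln K"
        using K by (intro mult_left_mono) auto
      also have "\<dots> \<le> 2 * q * ln K"
        using K by simp
      finally show ?thesis
        using \<beta> by simp
    qed
    finally show ?thesis .
  qed
  moreover have "0 < 2 * q * ln K"
    using K q by simp
  ultimately show ?thesis
    by blast
qed

subsection \<open>Step weights\<close>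

text \<open>Any exponent below -1 is summable over the integers; \<open>max 1\<close> takes care of
  \<open>z = 0\<close>. One-dimensional weights make the sum over all steps factorise into
  coordinates.\<close>

definition coord_weight :: "int \<Rightarrow> real" where
  "coord_weight z = max 1 \<bar>real_of_int z\<bar> powr (- 3 / 2)"

text \<open>The factor \<open>4 ^ d\<close> pays for replacing \<open>k - 1\<close>, the lower bound
  for distances between cells, by \<open>k / 2\<close>.\<close>

definition step_weight :: "int ^ 'd::finite \<Rightarrow> int ^ 'd \<Rightarrow> real" where
  "step_weight x y = 4 ^ CARD('d) * (\<Prod>i\<in>UNIV. coord_weight (x $ i - y $ i))"

lemma coord_weight_nonneg [simp]: "0 \<le> coord_weight z"
  by (simp add: coord_weight_def)

lemma step_weight_nonneg [simp]: "0 \<le> step_weight x y"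
  by (simp add: step_weight_def prod_nonneg)

lemma coord_weight_sum_bound:
  "\<exists>S\<ge>1. \<forall>Z. finite Z \<longrightarrow> (\<Sum>z\<in>Z. coord_weight z) \<le> S"
proof -
  let ?f = "\<lambda>n. coord_weight (int n)"
  have "summable (\<lambda>n. real n powr (- 3 / 2))"
    by (simp add: summable_real_powr_iff)
  moreover have "eventually (\<lambda>n. ?f n = real n powr (- 3 / 2)) sequentially"
    using eventually_ge_at_top[of 1] by eventually_elim (simp add: coord_weight_def max_def)
  ultimately have sum: "summable ?f"
    using summable_cong[of ?f "\<lambda>n. real n powr (- 3 / 2)"] by blast
  define S where "S = 2 * (\<Sum>n. ?f n) + 1"
  have "(\<Sum>z\<in>Z. coord_weight z) \<le> S" if "finite Z" for Z
  proof -
    define N where "N = Max (insert 0 ((nat \<circ> abs) ` Z))"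
    have N: "nat \<bar>z\<bar> \<le> N" if "z \<in> Z" for z
      unfolding N_def using \<open>finite Z\<close> that by (intro Max_ge) auto
    have "Z \<subseteq> int ` {..N} \<union> (\<lambda>n. - int n) ` {..N}"
    proof
      fix z
      assume "z \<in> Z"
      then have "nat \<bar>z\<bar> \<in> {..N}" "z = int (nat \<bar>z\<bar>) \<or> z = - int (nat \<bar>z\<bar>)"
        using N by auto
      then show "z \<in> int ` {..N} \<union> (\<lambda>n. - int n) ` {..N}"
        by blast
    qed
    then have "(\<Sum>z\<in>Z. coord_weight z) \<le> (\<Sum>z\<in>int ` {..N} \<union> (\<lambda>n. - int n) ` {..N}. coord_weight z)"
      by (intro sum_mono2) auto
    also have "\<dots> \<le> (\<Sum>z\<in>int ` {..N}. coord_weight z) + (\<Sum>z\<in>(\<lambda>n. - int n) ` {..N}. coord_weight z)"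
      by (subst sum_Un) (auto simp: sum_nonneg)
    also have "\<dots> = 2 * (\<Sum>n\<le>N. ?f n)"
      by (simp add: sum.reindex inj_on_def coord_weight_def)
    also have "\<dots> \<le> S"
      unfolding S_def using sum_le_suminf[OF sum, of "{..N}"] by simp
    finally show ?thesis .
  qed
  moreover have "S \<ge> 1"
    unfolding S_def using suminf_nonneg[OF sum] by simp
  ultimately show ?thesis
    by blast
qed

lemma sum_box_prod:
  fixes f :: "'d::finite \<Rightarrow> int \<Rightarrow> real"
  shows "(\<Sum>y\<in>(lattice_box n :: (int ^ 'd) set). \<Prod>i\<in>UNIV. f i (y $ i))
    = (\<Prod>i\<in>UNIV. \<Sum>k\<in>{0..<int n}. f i k)"
proof -
  have "(\<Prod>i\<in>UNIV. \<Sum>k\<in>{0..<int n}. f i k)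
      = (\<Sum>g\<in>Pi\<^sub>E UNIV (\<lambda>_. {0..<int n}). \<Prod>i\<in>UNIV. f i (g i))"
    by (rule prod_sum_PiE) auto
  also have "\<dots> = (\<Sum>y\<in>(lattice_box n :: (int ^ 'd) set). \<Prod>i\<in>UNIV. f i (y $ i))"
    by (rule sum.reindex_bij_witness[of _ vec_nth vec_lambda]) (auto simp: lattice_box_def)
  finally show ?thesis ..
qed

text \<open>Each coordinate sum is bounded uniformly in \<open>x\<close> and \<open>n\<close>. The
  constants of the lower bound depend on the dimension only through this \<open>C\<close>.\<close>

lemma step_weight_sum_bound:
  "\<exists>C\<ge>1. \<forall>n x. (\<Sum>y\<in>lattice_box n. step_weight x (y :: int ^ 'd::finite)) \<le> C"
proof -
  obtain S where S: "S \<ge> 1" "\<And>Z. finite Z \<Longrightarrow> (\<Sum>z\<in>Z. coord_weight z) \<le> S"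
    using coord_weight_sum_bound by blast
  let ?d = "CARD('d)"
  have "(\<Sum>y\<in>lattice_box n. step_weight x (y :: int ^ 'd)) \<le> 4 ^ ?d * S ^ ?d" for n x
  proof -
    have "(\<Sum>y\<in>lattice_box n. step_weight x (y :: int ^ 'd))
        = 4 ^ ?d * (\<Prod>i\<in>UNIV. \<Sum>k\<in>{0..<int n}. coord_weight (x $ i - k))"
      unfolding step_weight_def sum_distrib_left[symmetric]
      using sum_box_prod[of "\<lambda>i k. coord_weight (x $ i - k)" n] by simp
    also have "\<dots> \<le> 4 ^ ?d * (\<Prod>i\<in>(UNIV :: 'd set). S)"
    proof (intro mult_left_mono prod_mono conjI sum_nonneg)
      fix i
      have "(\<Sum>k\<in>{0..<int n}. coord_weight (x $ i - k))
          = (\<Sum>z\<in>(\<lambda>k. x $ i - k) ` {0..<int n}. coord_weight z)"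
        by (subst sum.reindex) (auto simp: inj_on_def)
      also have "\<dots> \<le> S"
        by (intro S(2)) auto
      finally show "(\<Sum>k\<in>{0..<int n}. coord_weight (x $ i - k)) \<le> S" .
    qed auto
    finally show ?thesis
      by simp
  qed
  moreover have "1 \<le> 4 ^ ?d * S ^ ?d"
    using S(1) mult_mono[of 1 "4 ^ ?d" 1 "S ^ ?d"] by (simp add: one_le_power)
  ultimately show ?thesis
    by blast
qed

text \<open>Splitting off the factor \<open>k powr (-1/2)\<close> keeps the weights summable in every dimension,
  since \<open>2 * d \<ge> 3 / 2 * d + 1 / 2\<close>.\<close>

lemma pair_prob_le_step_weight:
  fixes x y :: "int ^ 'd::finite"
  assumes \<beta>: "\<beta> \<ge> 1" and "x \<noteq> y"
  shows "pair_prob \<beta> x y \<le> \<beta> * step_weight x y / sqrt (real (idist x y))"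
proof -
  let ?d = "CARD('d)" and ?k = "real (idist x y)"
  have k: "?k \<ge> 1"
    using assms(2) idist_eq_0_iff[of x y] by linarith
  have d: "real ?d \<ge> 1"
    by (simp add: Suc_leI)
  have "?k powr (- 3 / 2) \<le> coord_weight (x $ i - y $ i)" for i
  proof -
    have "\<bar>real_of_int (x $ i - y $ i)\<bar> \<le> ?k"
      using idist_comp_le[of x i y] by linarith
    then show ?thesis
      unfolding coord_weight_def using k by (intro powr_mono2') auto
  qed
  then have *: "(\<Prod>i\<in>(UNIV :: 'd set). ?k powr (- 3 / 2)) \<le> (\<Prod>i\<in>UNIV. coord_weight (x $ i - y $ i))"
    by (intro prod_mono) auto
  have prod: "?k powr (- 3 / 2 * ?d) \<le> (\<Prod>i\<in>UNIV. coord_weight (x $ i - y $ i))"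
  proof -
    have "(\<Prod>i\<in>(UNIV :: 'd set). ?k powr (- 3 / 2)) = ?k powr (- 3 / 2 * ?d)"
    proof -
      have "(\<Prod>i\<in>(UNIV :: 'd set). ?k powr (- 3 / 2)) = (?k powr (- 3 / 2)) ^ ?d"
        by simp
      also have "\<dots> = (?k powr (- 3 / 2)) powr real ?d"
        using k by (subst powr_realpow) auto
      also have "\<dots> = ?k powr (- 3 / 2 * ?d)"
        by (rule powr_powr)
      finally show ?thesis .
    qed
    with * show ?thesis
      by simp
  qed
  have "1 / ?k ^ (2 * ?d) = ?k powr (- (2 * real ?d))"
    using k by (simp add: powr_minus_divide powr_realpow[symmetric])
  also have "\<dots> \<le> ?k powr (- 3 / 2 * ?d - 1 / 2)"
  proof (rule powr_mono)
    show "- (2 * real ?d) \<le> - 3 / 2 * ?d - 1 / 2"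
      using d by linarith
  qed (rule k)
  also have "\<dots> = ?k powr (- 3 / 2 * ?d) / sqrt ?k"
    using k by (simp add: powr_diff powr_half_sqrt)
  also have "\<dots> \<le> (\<Prod>i\<in>UNIV. coord_weight (x $ i - y $ i)) / sqrt ?k"
    using prod by (intro divide_right_mono) auto
  finally have "4 ^ ?d * (1 / ?k ^ (2 * ?d)) \<le> step_weight x y / sqrt ?k"
    unfolding step_weight_def times_divide_eq_right[symmetric] by (intro mult_left_mono) auto
  then have main: "\<beta> * (4 ^ ?d * (1 / ?k ^ (2 * ?d))) \<le> \<beta> * step_weight x y / sqrt ?k"
    unfolding times_divide_eq_right[symmetric] using \<beta> by (intro mult_left_mono) auto
  have "pair_prob \<beta> x y \<le> \<beta> * (4 ^ ?d * (1 / ?k ^ (2 * ?d)))"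
  proof (cases "idist x y \<ge> 2")
    case True
    have "pair_prob \<beta> x y \<le> \<beta> * kernel_weight x y"
      using exp_ge_add_one_self[of "- \<beta> * kernel_weight x y"] by (simp add: pair_prob_far[OF True])
    also have "\<dots> \<le> \<beta> * (1 / (?k - 1) ^ (2 * ?d))"
      using \<beta> by (intro mult_left_mono kernel_weight_le True) auto
    also have "\<dots> \<le> \<beta> * (1 / (?k / 2) ^ (2 * ?d))"
      using True \<beta> by (intro mult_left_mono divide_left_mono power_mono mult_pos_pos zero_less_power) auto
    also have "\<dots> = \<beta> * (4 ^ ?d * (1 / ?k ^ (2 * ?d)))"
      by (simp add: power_divide power_mult)
    finally show ?thesis .
  next
    case False
    then have "idist x y = 1"
      using k by linarith
    then show ?thesis
      using \<beta> mult_mono[of 1 \<beta> 1 "4 ^ ?d"] by (simp add: pair_prob_adjacent)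
  qed
  then show ?thesis
    using main by linarith
qed

subsection \<open>Walks\<close>

fun walk_edges :: "'a \<Rightarrow> 'a list \<Rightarrow> 'a set set" where
  "walk_edges x [] = {}"
| "walk_edges x (y # ys) = insert {x, y} (walk_edges y ys)"

fun walk_weight :: "('a \<Rightarrow> 'a \<Rightarrow> real) \<Rightarrow> 'a \<Rightarrow> 'a list \<Rightarrow> real" where
  "walk_weight w x [] = 1"
| "walk_weight w x (y # ys) = w x y * walk_weight w y ys"

fun long_steps :: "nat \<Rightarrow> int ^ 'd::finite \<Rightarrow> (int ^ 'd) list \<Rightarrow> nat" where
  "long_steps r x [] = 0"
| "long_steps r x (y # ys) = (if idist x y > r then 1 else 0) + long_steps r y ys"

lemma finite_walk_edges [simp]: "finite (walk_edges x xs)"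
  by (induction x xs rule: walk_edges.induct) auto

lemma walk_edges_subset: "e \<in> walk_edges x xs \<Longrightarrow> e \<subseteq> set (x # xs)"
  by (induction x xs rule: walk_edges.induct) auto

lemma walk_edges_in:
  "distinct (x # xs) \<Longrightarrow> set (x # xs) \<subseteq> A \<Longrightarrow> walk_edges x xs \<subseteq> edges_in A"
  by (induction x xs rule: walk_edges.induct) (auto simp: edges_in_iff)

lemma walk_edges_suffix:
  "x # xs = ps @ u # qs \<Longrightarrow> walk_edges u qs \<subseteq> walk_edges x xs"
proof (induction ps arbitrary: x xs)
  case (Cons p ps)
  then obtain y ys where xs: "xs = y # ys" "y # ys = ps @ u # qs"
    by (cases xs) auto
  have "walk_edges u qs \<subseteq> walk_edges y ys"
    by (rule Cons.IH[OF xs(2)])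
  then show ?case
    unfolding xs(1) walk_edges.simps by blast
qed auto

lemma walk_weight_nonneg: "(\<And>x y. 0 \<le> w x y) \<Longrightarrow> 0 \<le> walk_weight w x xs"
  by (induction w x xs rule: walk_weight.induct) auto

lemma sum_walk_weight_le:
  assumes fin: "finite X" and nonneg: "\<And>x y. 0 \<le> w x y" and sum: "\<And>x. (\<Sum>y\<in>X. w x y) \<le> \<Gamma>"
  shows "(\<Sum>xs | set xs \<subseteq> X \<and> length xs = k. walk_weight w x xs) \<le> \<Gamma> ^ k"
proof (induction k arbitrary: x)
  case 0
  have "{xs. set xs \<subseteq> X \<and> length xs = 0} = {[]}"
    by auto
  then show ?case by simp
next
  case (Suc k)
  let ?L = "{xs. set xs \<subseteq> X \<and> length xs = k}"
  have \<Gamma>: "0 \<le> \<Gamma>"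
    using sum[of x] nonneg by (meson order_trans sum_nonneg)
  have L: "{xs. set xs \<subseteq> X \<and> length xs = Suc k} = (\<lambda>(y, ys). y # ys) ` (X \<times> ?L)"
    by (auto simp: length_Suc_conv image_iff)
  have "(\<Sum>xs | set xs \<subseteq> X \<and> length xs = Suc k. walk_weight w x xs)
      = (\<Sum>(y, ys)\<in>X \<times> ?L. w x y * walk_weight w y ys)"
    unfolding L by (subst sum.reindex) (auto simp: inj_on_def intro!: sum.cong)
  also have "\<dots> = (\<Sum>y\<in>X. w x y * (\<Sum>ys\<in>?L. walk_weight w y ys))"
    by (simp add: sum.cartesian_product sum_distrib_left)
  also have "\<dots> \<le> (\<Sum>y\<in>X. w x y * \<Gamma> ^ k)"
    by (intro sum_mono mult_left_mono Suc.IH nonneg)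
  also have "\<dots> = (\<Sum>y\<in>X. w x y) * \<Gamma> ^ k"
    by (simp add: sum_distrib_right)
  also have "\<dots> \<le> \<Gamma> * \<Gamma> ^ k"
    using \<Gamma> by (intro mult_right_mono sum) auto
  finally show ?case by simp
qed

lemma prob_all_open:
  assumes "finite A" "\<beta> \<ge> 0" "F \<subseteq> edges_in A"
  shows "measure_pmf.prob (box_pmf \<beta> A) {\<omega>. \<forall>e\<in>F. \<omega> e} = (\<Prod>e\<in>F. edge_prob \<beta> e)"
proof -
  let ?E = "edges_in A" and ?B = "\<lambda>e. bernoulli_pmf (edge_prob \<beta> e)"
  have "{\<omega>. \<forall>e\<in>F. \<omega> e} = Pi ?E (\<lambda>e. if e \<in> F then {True} else UNIV)"
    using assms(3) by (auto simp: Pi_iff split: if_splits)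
  then have "measure_pmf.prob (box_pmf \<beta> A) {\<omega>. \<forall>e\<in>F. \<omega> e}
      = (\<Prod>e\<in>?E. measure_pmf.prob (?B e) (if e \<in> F then {True} else UNIV))"
    unfolding box_pmf_def using assms(1) by (simp add: measure_Pi_pmf_Pi)
  also have "\<dots> = (\<Prod>e\<in>?E. if e \<in> F then edge_prob \<beta> e else 1)"
  proof (intro prod.cong refl)
    fix e
    assume "e \<in> ?E"
    then have "0 \<le> edge_prob \<beta> e \<and> edge_prob \<beta> e \<le> 1"
      using edges_in_subset_edges by (intro edge_prob_bounds assms(2)) blast
    then show "measure_pmf.prob (?B e) (if e \<in> F then {True} else UNIV)
        = (if e \<in> F then edge_prob \<beta> e else 1)"
      by (simp add: measure_pmf_single)
  qed
  also have "\<dots> = (\<Prod>e\<in>F. edge_prob \<beta> e)"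
    using assms by (simp add: prod.If_cases Int_absorb1 flip: prod.inter_restrict)
  finally show ?thesis .
qed

text \<open>In a self-avoiding walk the first edge never recurs, so its factor splits off. For a
  step longer than \<open>q ^ 20\<close>, the spare divisor \<open>sqrt (idist x y)\<close> is at
  least \<open>q ^ 10\<close>; for shorter steps it is estimated by 1.\<close>

lemma prob_walk_le:
  fixes x :: "int ^ 'd::finite"
  assumes \<beta>: "\<beta> \<ge> 1" and q: "q \<ge> 1" and "distinct (x # xs)"
  shows "(\<Prod>e\<in>walk_edges x xs. edge_prob \<beta> e)
    \<le> walk_weight (\<lambda>x y. \<beta> * step_weight x y) x xs * (1 / real q ^ 10) ^ long_steps (q ^ 20) x xs"
  using assms(3)
proof (induction xs arbitrary: x)
  case (Cons y ys)
  have new: "{x, y} \<notin> walk_edges y ys"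
    using walk_edges_subset[of "{x, y}" y ys] Cons.prems by auto
  have xy: "x \<noteq> y"
    using Cons.prems by auto
  have k: "real (idist x y) \<ge> 1"
    using xy idist_eq_0_iff[of x y] by linarith
  have "edge_prob \<beta> {x, y} \<le> \<beta> * step_weight x y / sqrt (real (idist x y))"
    using pair_prob_le_step_weight[OF \<beta> xy] xy by (simp add: edge_prob_eq)
  also have "\<dots> \<le> \<beta> * step_weight x y * (1 / real q ^ 10) ^ (if idist x y > q ^ 20 then 1 else 0)"
  proof (cases "idist x y > q ^ 20")
    case True
    have "sqrt (real q ^ 20) \<le> sqrt (real (idist x y))"
      using True by (intro real_sqrt_le_mono) (metis less_imp_le of_nat_le_iff of_nat_power)
    moreover have "sqrt (real q ^ 20) = real q ^ 10"
      by (rule real_sqrt_unique) (auto simp flip: power_mult)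
    ultimately have "real q ^ 10 \<le> sqrt (real (idist x y))"
      by simp
    then have "\<beta> * step_weight x y / sqrt (real (idist x y)) \<le> \<beta> * step_weight x y / real q ^ 10"
      using \<beta> q k by (intro divide_left_mono mult_pos_pos) auto
    then show ?thesis
      using True by simp
  next
    case False
    have "\<beta> * step_weight x y / sqrt (real (idist x y)) \<le> \<beta> * step_weight x y / 1"
      using k \<beta> by (intro divide_left_mono) auto
    then show ?thesis
      using False by simp
  qed
  finally have step: "edge_prob \<beta> {x, y}
    \<le> \<beta> * step_weight x y * (1 / real q ^ 10) ^ (if idist x y > q ^ 20 then 1 else 0)" .
  have "(\<Prod>e\<in>walk_edges x (y # ys). edge_prob \<beta> e)
      = edge_prob \<beta> {x, y} * (\<Prod>e\<in>walk_edges y ys. edge_prob \<beta> e)"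
    using new by simp
  also have "\<dots> \<le> (\<beta> * step_weight x y * (1 / real q ^ 10) ^ (if idist x y > q ^ 20 then 1 else 0)) *
      (walk_weight (\<lambda>x y. \<beta> * step_weight x y) y ys * (1 / real q ^ 10) ^ long_steps (q ^ 20) y ys)"
  proof (intro mult_mono step Cons.IH)
    have "walk_edges y ys \<subseteq> edges"
      using walk_edges_in[of y ys UNIV] Cons.prems edges_in_subset_edges by auto
    then show "0 \<le> (\<Prod>e\<in>walk_edges y ys. edge_prob \<beta> e)"
      using edge_prob_bounds[of \<beta>] \<beta> by (intro prod_nonneg) auto
  qed (use Cons.prems \<beta> in auto)
  also have "\<dots> = walk_weight (\<lambda>x y. \<beta> * step_weight x y) x (y # ys)
      * (1 / real q ^ 10) ^ long_steps (q ^ 20) x (y # ys)"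
    by (simp only: walk_weight.simps long_steps.simps power_add mult_ac)
  finally show ?case .
qed simp

text \<open>Loop erasure: if \<open>u\<close> reappears in the self-avoiding walk built from its
  successor, everything before that occurrence is dropped.\<close>

lemma relpow_distinct_walk:
  assumes "(u, v) \<in> open_step \<omega> A ^^ k" "u \<in> A"
  shows "\<exists>xs. distinct (u # xs) \<and> set (u # xs) \<subseteq> A \<and> length xs \<le> k \<and> last (u # xs) = v
    \<and> (\<forall>e\<in>walk_edges u xs. \<omega> e)"
  using assms
proof (induction k arbitrary: u)
  case 0
  then show ?case
    by (intro exI[of _ "[]"]) auto
next
  case (Suc k)
  then obtain w where w: "(u, w) \<in> open_step \<omega> A" "(w, v) \<in> open_step \<omega> A ^^ k"
    by (metis relpow_Suc_D2)
  then have uw: "w \<in> A" "\<omega> {u, w}" "u \<noteq> w"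
    by (auto simp: open_step_iff)
  obtain ys where ys: "distinct (w # ys)" "set (w # ys) \<subseteq> A" "length ys \<le> k" "last (w # ys) = v"
    "\<forall>e\<in>walk_edges w ys. \<omega> e"
    using Suc.IH[OF w(2) uw(1)] by blast
  show ?case
  proof (cases "u \<in> set (w # ys)")
    case False
    then show ?thesis
      using ys uw Suc.prems(2) by (intro exI[of _ "w # ys"]) auto
  next
    case True
    then obtain ps qs where pq: "w # ys = ps @ u # qs"
      by (meson split_list)
    have "last (u # qs) = v"
      using ys(4) unfolding pq by simp
    moreover have "distinct (u # qs)" "set (u # qs) \<subseteq> A"
      using ys(1,2) unfolding pq by auto
    moreover have "length qs \<le> Suc k"
      using arg_cong[OF pq, of length] ys(3) by simp
    ultimately show ?thesis
      using walk_edges_suffix[OF pq] ys(5) by (intro exI[of _ qs]) blast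
  qed
qed

subsection \<open>The lower bound\<close>

text \<open>The exceptional event of the renormalisation step. With fewer than a tenth of long
  steps, the bookkeeping of \<open>coarse_walk\<close> halves the allowed length.\<close>

definition many_long_steps :: "nat \<Rightarrow> nat \<Rightarrow> nat \<Rightarrow> ((int ^ 'd::finite) set \<Rightarrow> bool) set" where
  "many_long_steps r n t = {\<omega>. \<exists>xs. distinct (0 # xs) \<and> set (0 # xs) \<subseteq> lattice_box n \<and>
    length xs \<le> t \<and> t \<le> 10 * long_steps r 0 xs \<and> (\<forall>e\<in>walk_edges 0 xs. \<omega> e)}"

text \<open>A union bound over walks. With \<open>\<Gamma> = \<beta> * C\<close> their total weight
  is at most \<open>(t + 1) * \<Gamma> ^ t \<le> (2 * \<Gamma>) ^ t\<close>, while the long steps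
  together contribute at most \<open>(1 / q) ^ t\<close>. The choice
  \<open>q \<ge> 8 * \<Gamma>\<close> leaves \<open>1 / 4\<close> per step.\<close>

lemma prob_many_long_steps:
  assumes \<beta>: "\<beta> \<ge> 1" and C: "C \<ge> 1"
    and sum: "\<And>x. (\<Sum>y\<in>lattice_box n. step_weight x (y :: int ^ 'd::finite)) \<le> C"
    and q: "8 * (\<beta> * C) \<le> real q"
  shows "measure_pmf.prob (box_pmf \<beta> (lattice_box n))
    (many_long_steps (q ^ 20) n t :: ((int ^ 'd) set \<Rightarrow> bool) set) \<le> (1 / 4) ^ t"
proof -
  let ?V = "lattice_box n :: (int ^ 'd) set"
  let ?P = "measure_pmf.prob (box_pmf \<beta> ?V)"
  let ?w = "\<lambda>x y :: int ^ 'd. \<beta> * step_weight x y"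
  let ?L = "\<lambda>k. {xs. set xs \<subseteq> ?V \<and> length xs = k}"
  define \<Gamma> where "\<Gamma> = \<beta> * C"
  have \<Gamma>: "\<Gamma> \<ge> 1"
    unfolding \<Gamma>_def using mult_mono[of 1 \<beta> 1 C] \<beta> C by simp
  have q1: "q \<ge> 1" "8 * \<Gamma> \<le> real q"
    using q \<Gamma> by (auto simp: \<Gamma>_def)
  define W where "W = {xs. distinct (0 # xs) \<and> set (0 # xs) \<subseteq> ?V \<and> length xs \<le> t
    \<and> t \<le> 10 * long_steps (q ^ 20) 0 xs}"
  have W_sub: "W \<subseteq> (\<Union>k\<in>{..t}. ?L k)"
    by (auto simp: W_def)
  have fin_L: "finite (?L k)" for k
    by (rule finite_lists_length_eq) simp
  then have fin_U: "finite (\<Union>k\<in>{..t}. ?L k)"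
    by auto
  then have fin_W: "finite W"
    using W_sub finite_subset by blast
  have "(many_long_steps (q ^ 20) n t :: ((int ^ 'd) set \<Rightarrow> bool) set)
      = (\<Union>xs\<in>W. {\<omega>. \<forall>e\<in>walk_edges 0 xs. \<omega> e})"
    by (auto simp: many_long_steps_def W_def)
  then have "?P (many_long_steps (q ^ 20) n t) \<le> (\<Sum>xs\<in>W. ?P {\<omega>. \<forall>e\<in>walk_edges 0 xs. \<omega> e})"
    using fin_W by (simp add: measure_pmf.finite_measure_subadditive_finite)
  also have "\<dots> \<le> (\<Sum>xs\<in>W. walk_weight ?w 0 xs * (1 / real q) ^ t)"
  proof (intro sum_mono)
    fix xs
    assume xs: "xs \<in> W"
    then have "?P {\<omega>. \<forall>e\<in>walk_edges 0 xs. \<omega> e} = (\<Prod>e\<in>walk_edges 0 xs. edge_prob \<beta> e)"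
      using \<beta> by (intro prob_all_open walk_edges_in) (auto simp: W_def)
    also have "\<dots> \<le> walk_weight ?w 0 xs * (1 / real q ^ 10) ^ long_steps (q ^ 20) 0 xs"
      using \<beta> q1 xs by (intro prob_walk_le) (auto simp: W_def)
    also have "\<dots> = walk_weight ?w 0 xs * (1 / real q) ^ (10 * long_steps (q ^ 20) 0 xs)"
      by (simp add: power_mult power_one_over)
    also have "\<dots> \<le> walk_weight ?w 0 xs * (1 / real q) ^ t"
      using xs q1 \<beta> by (intro mult_left_mono power_decreasing walk_weight_nonneg) (auto simp: W_def)
    finally show "?P {\<omega>. \<forall>e\<in>walk_edges 0 xs. \<omega> e} \<le> walk_weight ?w 0 xs * (1 / real q) ^ t" .
  qed
  also have "\<dots> = (\<Sum>xs\<in>W. walk_weight ?w 0 xs) * (1 / real q) ^ t"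
    by (simp add: sum_distrib_right)
  also have "\<dots> \<le> (2 * \<Gamma>) ^ t * (1 / real q) ^ t"
  proof (intro mult_right_mono)
    have "(\<Sum>xs\<in>W. walk_weight ?w 0 xs) \<le> (\<Sum>xs\<in>(\<Union>k\<in>{..t}. ?L k). walk_weight ?w 0 xs)"
      using \<beta> by (intro sum_mono2 fin_U W_sub walk_weight_nonneg) auto
    also have "\<dots> = (\<Sum>k\<le>t. \<Sum>xs\<in>?L k. walk_weight ?w 0 xs)"
      using fin_L by (intro sum.UNION_disjoint) auto
    also have "\<dots> \<le> (\<Sum>k\<le>t. \<Gamma> ^ k)"
    proof (intro sum_mono sum_walk_weight_le)
      fix x :: "int ^ 'd"
      show "(\<Sum>y\<in>?V. \<beta> * step_weight x y) \<le> \<Gamma>"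
        unfolding \<Gamma>_def sum_distrib_left[symmetric] using \<beta> by (intro mult_left_mono sum) auto
    qed (use \<beta> in auto)
    also have "\<dots> \<le> (\<Sum>k\<le>t. \<Gamma> ^ t)"
      using \<Gamma> by (intro sum_mono power_increasing) auto
    also have "\<dots> = real (t + 1) * \<Gamma> ^ t"
      by simp
    also have "\<dots> \<le> 2 ^ t * \<Gamma> ^ t"
    proof (intro mult_right_mono)
      have "t + 1 \<le> 2 ^ t"
        using less_exp[of t] by linarith
      then show "real (t + 1) \<le> 2 ^ t"
        by (metis of_nat_le_iff of_nat_numeral of_nat_power)
    qed (use \<Gamma> in auto)
    finally show "(\<Sum>xs\<in>W. walk_weight ?w 0 xs) \<le> (2 * \<Gamma>) ^ t"
      by (simp add: power_mult_distrib)
  qed simp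
  also have "(2 * \<Gamma>) ^ t * (1 / real q) ^ t = (2 * \<Gamma> / real q) ^ t"
    by (simp only: power_mult_distrib[symmetric] times_divide_eq_right mult_1_right)
  also have "\<dots> \<le> (1 / 4) ^ t"
  proof (rule power_mono)
    show "2 * \<Gamma> / real q \<le> 1 / 4"
      using q1 \<Gamma> by (simp add: field_simps)
  qed (use \<Gamma> in simp)
  finally show ?thesis .
qed

text \<open>The walk is followed in the coarse graph by a lazy pointer \<open>z\<close>, which is updated only at long
  steps and after ten short ones: a long step costs at most two coarse steps, while ten short steps
  stay within one block length and cost one.\<close>

lemma coarse_walk:
  fixes D :: "int ^ 'd::finite \<Rightarrow> enat"
  assumes r: "r \<ge> 1"
    and adj: "\<And>x y. x \<in> V \<Longrightarrow> y \<in> V \<Longrightarrow> idist x y \<le> 10 * r \<Longrightarrow> D y \<le> D x + 1"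
    and edge: "\<And>x y. x \<in> V \<Longrightarrow> y \<in> V \<Longrightarrow> x \<noteq> y \<Longrightarrow> \<omega> {x, y} \<Longrightarrow> D y \<le> D x + 1"
    and "distinct (x # xs)" "set (x # xs) \<subseteq> V" "\<forall>e\<in>walk_edges x xs. \<omega> e"
    and "z \<in> V" "D z \<le> enat m" "idist z x \<le> l * r" "l \<le> 10"
  shows "\<exists>m'. D (last (x # xs)) \<le> enat m' \<and>
    10 * m' \<le> 10 * m + l + length xs + 20 * long_steps r x xs + 10"
  using assms(4-)
proof (induction xs arbitrary: x z m l)
  case Nil
  \<comment> \<open>The final \<open>+ 10\<close> in the claim, which counts coarse steps tenfold,
    pays for one last move from the pointer to the end of the walk.\<close>
  have "idist z x \<le> 10 * r"
    using Nil.prems(6,7) by (meson mult_le_mono1 order_trans)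
  then have "D x \<le> D z + 1"
    using Nil.prems by (intro adj) auto
  also have "\<dots> \<le> enat m + 1"
    using Nil.prems(5) by (rule add_right_mono)
  finally show ?case
    by (intro exI[of _ "m + 1"]) (simp add: one_enat_def)
next
  case (Cons y ys)
  have IH: "\<exists>m'. D (last (y # ys)) \<le> enat m' \<and>
      10 * m' \<le> 10 * m1 + l1 + length ys + 20 * long_steps r y ys + 10"
    if "z1 \<in> V" "D z1 \<le> enat m1" "idist z1 y \<le> l1 * r" "l1 \<le> 10" for z1 m1 l1
    using Cons.prems that by (intro Cons.IH[of y z1 m1 l1]) auto
  have x: "x \<in> V" "y \<in> V" "x \<noteq> y" "\<omega> {x, y}"
    using Cons.prems by auto
  have "idist z x \<le> 10 * r"
    using Cons.prems(6,7) by (meson mult_le_mono1 order_trans)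
  then have "D x \<le> D z + 1"
    using Cons.prems x by (intro adj) auto
  also have "\<dots> \<le> enat m + 1"
    using Cons.prems(5) by (rule add_right_mono)
  finally have Dx: "D x \<le> enat (m + 1)"
    by (simp add: one_enat_def)
  have "D y \<le> D x + 1"
    using x by (intro edge)
  also have "\<dots> \<le> enat (m + 1) + 1"
    using Dx by (rule add_right_mono)
  finally have Dy: "D y \<le> enat (m + 2)"
    by (simp add: one_enat_def)
  show ?case
  proof (cases "idist x y > r")
    case True
    have "\<exists>m'. D (last (y # ys)) \<le> enat m' \<and>
        10 * m' \<le> 10 * (m + 2) + 0 + length ys + 20 * long_steps r y ys + 10"
      using x Dy by (intro IH[of y]) auto
    then show ?thesis
      using True by fastforce
  next
    case short: False
    show ?thesis
    proof (cases "l < 10")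
      case True
      have "idist z y \<le> (l + 1) * r"
        using idist_triangle[of z y x] Cons.prems(6) short by (simp add: algebra_simps)
      then have "\<exists>m'. D (last (y # ys)) \<le> enat m' \<and>
          10 * m' \<le> 10 * m + (l + 1) + length ys + 20 * long_steps r y ys + 10"
        using Cons.prems True by (intro IH[of z]) auto
      then show ?thesis
        using short by fastforce
    next
      case False
      \<comment> \<open>The counter is full: its ten units pay for moving the pointer to
        \<open>x\<close>, and the current short step opens a new count at 1.\<close>
      have "\<exists>m'. D (last (y # ys)) \<le> enat m' \<and>
          10 * m' \<le> 10 * (m + 1) + 1 + length ys + 20 * long_steps r y ys + 10"
        using x Dx short by (intro IH[of x]) auto
      then show ?thesis
        using False Cons.prems(7) short by fastforce
    qed
  qed
qed

text \<open>Together with the origin, a pair of points that merging blocks reproduces at the smaller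
  scale, so the same event can be iterated.\<close>

definition corner :: "nat \<Rightarrow> int ^ 'd" where
  "corner n = (\<chi> i. int n - 1)"

lemma corner_in_box: "n \<ge> 1 \<Longrightarrow> corner n \<in> lattice_box n"
  by (simp add: corner_def lattice_box_def)

lemma block_corner:
  assumes "m \<ge> 1"
  shows "block m (corner (m * n)) = corner n"
proof -
  have "int (m * n) - 1 = (int m - 1) + int m * (int n - 1)"
    by (simp add: algebra_simps)
  then have "(int (m * n) - 1) div int m = ((int m - 1) + int m * (int n - 1)) div int m"
    by (rule arg_cong)
  also have "\<dots> = int n - 1"
    using assms by (subst div_mult_self2) auto
  finally show ?thesis
    unfolding block_def corner_def vec_lambda_beta by (simp only:)
qed

lemma block_zero [simp]: "block m 0 = 0"
  by (simp add: block_def vec_eq_iff)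

definition prob_close :: "'d::finite itself \<Rightarrow> real \<Rightarrow> nat \<Rightarrow> nat \<Rightarrow> real" where
  "prob_close _ \<beta> n t = measure_pmf.prob (box_pmf \<beta> (lattice_box n))
    {\<omega>. graph_dist \<omega> (lattice_box n) (0 :: int ^ 'd) (corner n) \<le> enat t}"

lemma graph_dist_le_walk:
  assumes "graph_dist \<omega> (lattice_box n) 0 (corner n) \<le> enat t" "n \<ge> 1"
  obtains xs where "distinct (0 # xs)" "set (0 # xs) \<subseteq> lattice_box n" "length xs \<le> t"
    "last (0 # xs) = corner n" "\<forall>e\<in>walk_edges 0 xs. \<omega> e"
proof -
  obtain k where "k \<le> t" "(0, corner n) \<in> open_step \<omega> (lattice_box n) ^^ k"
    using graph_dist_leD[OF assms(1)] by blast
  then have k: "k \<le> t" "(0, corner n) \<in> open_step \<omega> (lattice_box n) ^^ k"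
    by auto
  obtain xs where "distinct (0 # xs)" "set (0 # xs) \<subseteq> lattice_box n" "length xs \<le> k"
    "last (0 # xs) = corner n" "\<forall>e\<in>walk_edges 0 xs. \<omega> e"
    using relpow_distinct_walk[OF k(2) lattice_box_zero[OF assms(2)]] by blast
  with k(1) show thesis
    by (intro that[of xs]) auto
qed

text \<open>Outside the exceptional event a short fine walk yields a coarse walk of at most half the
  allowed length, and the coarse configuration has exactly the law of the small box. Points within
  \<open>10 * r\<close> lie in equal or adjacent blocks, and an open edge either stays in a block or
  opens a coarse edge.\<close>

lemma prob_close_coarse:
  fixes \<beta> :: real
  assumes \<beta>: "\<beta> \<ge> 0" and r: "r \<ge> 1" and n: "n \<ge> 1" and t: "t \<ge> 10"
  shows "prob_close TYPE('d::finite) \<beta> (10 * r * n) (2 * t) \<le> prob_close TYPE('d) \<beta> n t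
    + measure_pmf.prob (box_pmf \<beta> (lattice_box (10 * r * n)))
        (many_long_steps r (10 * r * n) (2 * t) :: ((int ^ 'd) set \<Rightarrow> bool) set)"
proof -
  let ?m = "10 * r"
  let ?V = "lattice_box (?m * n) :: (int ^ 'd) set" and ?W = "lattice_box n :: (int ^ 'd) set"
  let ?Q = "box_pmf \<beta> ?V"
  let ?A = "{\<omega>. graph_dist \<omega> ?V 0 (corner (?m * n)) \<le> enat (2 * t)}"
  let ?B = "{\<omega>. graph_dist (coarse ?m n \<omega>) ?W 0 (corner n) \<le> enat t}"
  let ?L = "many_long_steps r (?m * n) (2 * t)"
  have m: "?m \<ge> 1" and mn: "?m * n \<ge> 1"
    using r n by auto
  note law = map_coarse_box_pmf[OF m \<beta>, of n, where 'd = 'd]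
  have sub: "\<omega> \<in> ?B \<union> ?L" if \<omega>: "\<omega> \<in> set_pmf ?Q" "\<omega> \<in> ?A" for \<omega>
  proof (rule ccontr)
    assume not: "\<omega> \<notin> ?B \<union> ?L"
    let ?D = "\<lambda>x. graph_dist (coarse ?m n \<omega>) ?W 0 (block ?m x)"
    obtain xs where xs: "distinct (0 # xs)" "set (0 # xs) \<subseteq> ?V" "length xs \<le> 2 * t"
      "last (0 # xs) = corner (?m * n)" "\<forall>e\<in>walk_edges 0 xs. \<omega> e"
      using graph_dist_le_walk[of \<omega> "?m * n" "2 * t"] \<omega>(2) mn by blast
    have coarse_supp: "coarse ?m n \<omega> \<in> set_pmf (box_pmf \<beta> ?W)"
      unfolding law[symmetric] using \<omega>(1) by simp
    have "\<exists>m'. ?D (last (0 # xs)) \<le> enat m' \<and>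
        10 * m' \<le> 10 * 0 + 0 + length xs + 20 * long_steps r 0 xs + 10"
    proof (rule coarse_walk[where V = ?V and z = 0])
      fix x y
      assume xy: "x \<in> ?V" "y \<in> ?V"
      then have bl: "block ?m x \<in> ?W" "block ?m y \<in> ?W"
        by (auto simp: block_in_box_iff[OF m])
      have one: "?D y \<le> ?D x + 1"
        if "graph_dist (coarse ?m n \<omega>) ?W (block ?m x) (block ?m y) \<le> 1"
        using graph_dist_triangle[of "coarse ?m n \<omega>" ?W 0 "block ?m y" "block ?m x"] that
        by (meson add_left_mono order_trans)
      show "?D y \<le> ?D x + 1" if "idist x y \<le> ?m"
      proof (rule one)
        have "idist (block ?m x) (block ?m y) \<le> 1"
          using m that by (rule idist_block_le_1)
        with coarse_supp bl show "graph_dist (coarse ?m n \<omega>) ?W (block ?m x) (block ?m y) \<le> 1"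
          unfolding one_enat_def by (rule graph_dist_box_le_idist)
      qed
      show "?D y \<le> ?D x + 1" if "x \<noteq> y" "\<omega> {x, y}"
      proof (cases "block ?m x = block ?m y")
        case True
        then show ?thesis
          by simp
      next
        case False
        have "coarse ?m n \<omega> {block ?m x, block ?m y}"
          unfolding coarse_def using xy bl that False
          by (auto simp: edges_in_iff intro!: bexI[of _ "{x, y}"])
        then show ?thesis
          using bl False by (intro one graph_dist_open)
      qed
    qed (use r xs lattice_box_zero[OF mn] in \<open>auto simp: zero_enat_def\<close>)
    then obtain m' where m': "?D (corner (?m * n)) \<le> enat m'"
      "10 * m' \<le> length xs + 20 * long_steps r 0 xs + 10"
      using xs(4) by auto
    have "10 * long_steps r 0 xs < 2 * t"
      using not xs unfolding many_long_steps_def by (auto simp: not_le[symmetric])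
    \<comment> \<open>Indeed \<open>10 * m' \<le> 2 * t + 4 * t + 10\<close>, and
      \<open>t \<ge> 10\<close> absorbs the constant.\<close>
    then have "m' \<le> t"
      using m'(2) xs(3) t by linarith
    then have "?D (corner (?m * n)) \<le> enat t"
      using m'(1) by (meson enat_ord_simps(1) order_trans)
    then show False
      using not by (simp only: block_corner[OF m] Un_iff mem_Collect_eq) simp
  qed
  have "prob_close TYPE('d) \<beta> (?m * n) (2 * t) = measure_pmf.prob ?Q ?A"
    by (simp add: prob_close_def)
  also have "\<dots> \<le> measure_pmf.prob ?Q (?B \<union> ?L)"
    using sub by (intro measure_pmf.finite_measure_mono_AE AE_pmfI) auto
  also have "\<dots> \<le> measure_pmf.prob ?Q ?B + measure_pmf.prob ?Q ?L"
    by (rule measure_Un_le) auto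
  also have "measure_pmf.prob ?Q ?B = prob_close TYPE('d) \<beta> n t"
    unfolding prob_close_def law[symmetric] by (simp add: vimage_def)
  finally show ?thesis .
qed

lemma idist_walk_le:
  "long_steps r x xs = 0 \<Longrightarrow> idist x (last (x # xs)) \<le> r * length xs"
proof (induction xs arbitrary: x)
  case (Cons y ys)
  then have "idist x y \<le> r" "idist y (last (y # ys)) \<le> r * length ys"
    by (auto split: if_splits)
  then show ?case
    using idist_triangle[of x "last (y # ys)" y] by simp
qed simp

text \<open>The corner has coordinates \<open>10 * r + 1\<close>, one more than ten short steps can
  cover. A walk of length at most 10 must therefore contain a long step, which is already a tenth of
  10.\<close>

lemma prob_close_base:
  "prob_close TYPE('d::finite) \<beta> (10 * r + 2) 10
    \<le> measure_pmf.prob (box_pmf \<beta> (lattice_box (10 * r + 2)))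
        (many_long_steps r (10 * r + 2) 10 :: ((int ^ 'd) set \<Rightarrow> bool) set)"
  unfolding prob_close_def
proof (intro measure_pmf.finite_measure_mono subsetI)
  fix \<omega> :: "(int ^ 'd) set \<Rightarrow> bool"
  let ?n = "10 * r + 2"
  assume "\<omega> \<in> {\<omega>. graph_dist \<omega> (lattice_box ?n) (0 :: int ^ 'd) (corner ?n) \<le> enat 10}"
  then obtain xs where xs: "distinct ((0 :: int ^ 'd) # xs)" "set (0 # xs) \<subseteq> lattice_box ?n"
    "length xs \<le> 10" "last (0 # xs) = corner ?n" "\<forall>e\<in>walk_edges 0 xs. \<omega> e"
    using graph_dist_le_walk[of \<omega> ?n 10] by auto
  have "long_steps r 0 xs \<noteq> 0"
  proof
    assume "long_steps r 0 xs = 0"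
    then have "idist 0 (corner ?n :: int ^ 'd) \<le> r * length xs"
      using idist_walk_le[of r 0 xs] xs(4) by simp
    also have "\<dots> \<le> r * 10"
      using xs(3) by simp
    finally have "\<bar>(0 :: int ^ 'd) $ i - corner ?n $ i\<bar> \<le> int (r * 10)" for i
      by (simp only: idist_le_iff)
    then show False
      by (simp add: corner_def)
  qed
  then have "10 \<le> 10 * long_steps r 0 xs"
    by simp
  with xs show "\<omega> \<in> many_long_steps r ?n 10"
    unfolding many_long_steps_def by blast
qed auto

text \<open>The subtracted power strengthens the induction: passing from \<open>i\<close> to
  \<open>i + 1\<close> raises the bound by \<open>(1 / 2) ^ (i + 3)\<close>, which covers the
  failure probability at that scale, while the total stays below \<open>1 / 2\<close>.\<close>

lemma prob_close_le:
  fixes \<beta> :: real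
  assumes \<beta>: "\<beta> \<ge> 1" and C: "C \<ge> 1"
    and sum: "\<And>n x. (\<Sum>y\<in>lattice_box n. step_weight x (y :: int ^ 'd::finite)) \<le> C"
    and q: "8 * (\<beta> * C) \<le> real q"
  shows "prob_close TYPE('d) \<beta> ((10 * q ^ 20) ^ i * (10 * q ^ 20 + 2)) (10 * 2 ^ i)
    \<le> 1 / 2 - (1 / 2) ^ (i + 2)"
proof (induction i)
  case 0
  have "prob_close TYPE('d) \<beta> (10 * q ^ 20 + 2) 10 \<le> (1 / 4) ^ 10"
    using prob_close_base[of \<beta> "q ^ 20", where 'd = 'd]
      prob_many_long_steps[OF \<beta> C sum q, of "10 * q ^ 20 + 2" 10] by linarith
  then show ?case
    by (simp add: power_divide)
next
  case (Suc i)
  let ?r = "q ^ 20"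
  let ?n = "(10 * ?r) ^ i * (10 * ?r + 2)"
  let ?t = "10 * 2 ^ i :: nat"
  have "1 \<le> \<beta> * C"
    using mult_mono[of 1 \<beta> 1 C] \<beta> C by simp
  then have q1: "q \<ge> 1"
    using q by (cases q) auto
  have "prob_close TYPE('d) \<beta> (10 * ?r * ?n) (2 * ?t) \<le> prob_close TYPE('d) \<beta> ?n ?t
      + measure_pmf.prob (box_pmf \<beta> (lattice_box (10 * ?r * ?n)))
        (many_long_steps ?r (10 * ?r * ?n) (2 * ?t) :: ((int ^ 'd) set \<Rightarrow> bool) set)"
  proof (rule prob_close_coarse)
    show "1 \<le> ?r" and "1 \<le> ?n"
      using q1 by (simp_all add: Suc_le_eq)
  qed (use \<beta> in auto)
  also have "\<dots> \<le> (1 / 2 - (1 / 2) ^ (i + 2)) + (1 / 4) ^ (2 * ?t)"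
    by (intro add_mono Suc.IH prob_many_long_steps[OF \<beta> C sum q])
  also have "(1 / 4 :: real) ^ (2 * ?t) \<le> (1 / 2) ^ (2 * ?t)"
    by (intro power_mono) auto
  also have "(1 / 2 :: real) ^ (2 * ?t) \<le> (1 / 2) ^ (i + 3)"
  proof (rule power_decreasing)
    show "i + 3 \<le> 2 * ?t"
      using less_exp[of i] by linarith
  qed auto
  also have "1 / 2 - (1 / 2) ^ (i + 2) + (1 / 2) ^ (i + 3) = 1 / 2 - (1 / 2 :: real) ^ (Suc i + 2)"
    by (simp add: power_add power_divide)
  finally show ?case
    by (simp add: mult_ac)
qed

text \<open>Markov's inequality: the distance between the corners exceeds \<open>t\<close> with
  probability at least one half.\<close>

lemma Lambda_ge_prob_close:
  assumes "n \<ge> 1" "prob_close TYPE('d::finite) \<beta> n t \<le> 1 / 2"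
  shows "real t / 2 \<le> Lambda TYPE('d) n \<beta>"
proof -
  let ?V = "lattice_box n :: (int ^ 'd) set"
  let ?A = "{\<omega>. graph_dist \<omega> ?V 0 (corner n) \<le> enat t}"
  have "measure_pmf.prob (box_pmf \<beta> ?V) (- ?A) = 1 - prob_close TYPE('d) \<beta> n t"
    unfolding prob_close_def by (subst measure_pmf.prob_compl[symmetric]) (auto simp: Compl_eq_Diff_UNIV)
  then have half: "1 / 2 \<le> measure_pmf.prob (box_pmf \<beta> ?V) (- ?A)"
    using assms(2) by linarith
  have "ennreal (real t / 2) = of_nat t * ennreal (1 / 2)"
    unfolding ennreal_of_nat_eq_real_of_nat by (subst ennreal_mult[symmetric]) auto
  also have "\<dots> \<le> of_nat t * emeasure (box_pmf \<beta> ?V) (- ?A)"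
    unfolding measure_pmf.emeasure_eq_measure using half by (intro mult_left_mono ennreal_leI) auto
  also have "\<dots> = (\<integral>\<^sup>+ \<omega>. of_nat t * indicator (- ?A) \<omega> \<partial>box_pmf \<beta> ?V)"
    by (simp add: nn_integral_cmult)
  also have "\<dots> \<le> mean_dist \<beta> ?V 0 (corner n)"
    unfolding mean_dist_def
  proof (intro nn_integral_mono)
    fix \<omega> :: "(int ^ 'd) set \<Rightarrow> bool"
    show "of_nat t * indicator (- ?A) \<omega> \<le> ennreal_of_enat (graph_dist \<omega> ?V 0 (corner n))"
    proof (cases "\<omega> \<in> ?A")
      case False
      then have "enat t \<le> graph_dist \<omega> ?V 0 (corner n)"
        by simp
      then have "of_nat t \<le> ennreal_of_enat (graph_dist \<omega> ?V 0 (corner n))"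
        by (metis ennreal_of_enat_enat ennreal_of_enat_le_iff)
      then show ?thesis
        using False by simp
    qed simp
  qed
  also have "\<dots> \<le> ennreal (Lambda TYPE('d) n \<beta> - 1)"
    using assms(1) by (intro mean_dist_le_Lambda lattice_box_zero corner_in_box)
  finally show ?thesis
    using Lambda_ge_1[OF assms(1), of \<beta>, where 'd = 'd] by (simp add: ennreal_le_iff)
qed

lemma distance_exponent_lower:
  "\<exists>c>0. \<forall>\<beta>\<ge>2. c / ln \<beta> \<le> distance_exponent TYPE('d::finite) \<beta>"
proof -
  obtain C where C: "C \<ge> 1"
    and sum: "\<And>n x. (\<Sum>y\<in>lattice_box n. step_weight x (y :: int ^ 'd)) \<le> C"
    using step_weight_sum_bound by blast
  \<comment> \<open>Chosen for \<open>ln M \<le> K * ln \<beta>\<close>: the terms without \<beta>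
    are absorbed by \<open>ln 2 \<le> ln \<beta>\<close>, and 20 is the exponent of \<open>q\<close>
    in \<open>M\<close>.\<close>
  define K where "K = (ln 10 + 20 * ln (9 * C)) / ln 2 + 20"
  have K: "K > 0"
    unfolding K_def using C by (intro add_nonneg_pos divide_nonneg_pos) auto
  have "(ln 2 / K) / ln \<beta> \<le> distance_exponent TYPE('d) \<beta>" if \<beta>: "\<beta> \<ge> 2" for \<beta>
  proof -
    \<comment> \<open>Rounding up costs at most 1, which \<open>\<beta> * C \<ge> 1\<close> turns
      into the upper bound \<open>9 * (\<beta> * C)\<close>.\<close>
    define q where "q = nat \<lceil>8 * (\<beta> * C)\<rceil>"
    define M where "M = 10 * q ^ 20"
    define N where "N i = M ^ i * (M + 2)" for i
    have \<beta>C: "1 \<le> \<beta> * C"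
      using mult_mono[of 1 \<beta> 1 C] \<beta> C by simp
    have q: "8 * (\<beta> * C) \<le> real q" "real q \<le> 9 * (\<beta> * C)"
      unfolding q_def using \<beta>C by linarith+
    then have "0 < real q"
      using \<beta>C by linarith
    then have q1: "q \<ge> 1"
      by simp
    then have M: "M \<ge> 10"
      by (simp add: M_def)
    have L: "2 ^ i \<le> Lambda TYPE('d) (N i) \<beta>" for i
    proof -
      have "prob_close TYPE('d) \<beta> (N i) (10 * 2 ^ i) \<le> 1 / 2 - (1 / 2) ^ (i + 2)"
        unfolding N_def M_def using \<beta> by (intro prob_close_le[OF _ C sum q(1)]) auto
      moreover have "0 \<le> (1 / 2 :: real) ^ (i + 2)"
        by simp
      ultimately have "prob_close TYPE('d) \<beta> (N i) (10 * 2 ^ i) \<le> 1 / 2"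
        by linarith
      then have "real (10 * 2 ^ i) / 2 \<le> Lambda TYPE('d) (N i) \<beta>"
        using M by (intro Lambda_ge_prob_close) (simp_all add: N_def Suc_le_eq)
      moreover have "(2 :: real) ^ i \<le> real (10 * 2 ^ i) / 2"
        by simp
      ultimately show ?thesis
        by linarith
    qed
    let ?a = "\<lambda>n. ln (Lambda TYPE('d) n \<beta>) / ln (real n)"
    have "convergent ?a"
      using \<beta> by (intro convergent_Lambda_exponent) auto
    then have lim: "?a \<longlonglongrightarrow> distance_exponent TYPE('d) \<beta>"
      unfolding distance_exponent_def by (rule convergent_LIMSEQ_iff[THEN iffD1])
    \<comment> \<open>Distances double along the sides \<open>N i\<close> only. Since the full
      sequence converges, its limit may be evaluated along this subsequence.\<close>
    have "strict_mono N"
    proof (rule strict_monoI_Suc)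
      fix i
      have "N (Suc i) = M * N i" "0 < N i"
        using M by (simp_all add: N_def algebra_simps)
      then show "N i < N (Suc i)"
        using M by simp
    qed
    from LIMSEQ_subseq_LIMSEQ[OF lim this]
    have sub: "(\<lambda>i. ?a (N i)) \<longlonglongrightarrow> distance_exponent TYPE('d) \<beta>"
      by (simp add: o_def)
    have M0: "ln (real M) > 0"
      using M by simp
    have "(\<lambda>i. real i * ln 2 / (real i * ln (real M) + ln (real M + 2))) 
      \<longlonglongrightarrow> ln 2 * inverse (ln (real M))"
      using M0 by real_asymp
    moreover have "real i * ln 2 / (real i * ln (real M) + ln (real M + 2)) \<le> ?a (N i)" for i
    proof -
      have lnN: "ln (real (N i)) = real i * ln (real M) + ln (real M + 2)"
      proof -
        have "real (N i) = real M ^ i * (real M + 2)"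
          by (simp only: N_def of_nat_mult of_nat_add of_nat_power of_nat_numeral)
        then show ?thesis
          using M by (simp only:) (subst ln_mult, auto simp: ln_realpow)
      qed
      have "real i * ln 2 = ln (2 ^ i)"
        by (simp add: ln_realpow)
      also have "\<dots> \<le> ln (Lambda TYPE('d) (N i) \<beta>)"
        using L[of i] by (subst ln_le_cancel_iff) (auto intro: less_le_trans[OF _ L])
      finally show ?thesis
        unfolding lnN using M0 M by (intro divide_right_mono) auto
    qed
    ultimately have "ln 2 * inverse (ln (real M)) \<le> distance_exponent TYPE('d) \<beta>"
      using sub by (intro LIMSEQ_le) auto
    then have "ln 2 / ln (real M) \<le> distance_exponent TYPE('d) \<beta>"
      by (simp only: divide_inverse)
    moreover have "ln 2 / K / ln \<beta> \<le> ln 2 / ln (real M)"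
    proof -
      have ln\<beta>: "ln 2 \<le> ln \<beta>"
        using \<beta> by simp
      have "ln (real M) = ln 10 + 20 * ln (real q)"
        using q1 by (simp add: M_def ln_mult ln_realpow)
      also have "\<dots> \<le> ln 10 + 20 * ln (9 * C * \<beta>)"
        using q(2) q1 by (simp add: mult_ac)
      also have "\<dots> = ln 10 + 20 * ln (9 * C) + 20 * ln \<beta>"
        using C \<beta> by (simp add: ln_mult algebra_simps)
      also have "ln 10 + 20 * ln (9 * C) \<le> (ln 10 + 20 * ln (9 * C)) / ln 2 * ln \<beta>"
        using ln\<beta> C mult_left_mono[of "ln 2" "ln \<beta>" "ln 10 + 20 * ln (9 * C)"]
        by (simp add: field_simps)
      finally have "ln (real M) \<le> K * ln \<beta>"
        by (simp add: K_def algebra_simps)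
      then have "ln 2 / (K * ln \<beta>) \<le> ln 2 / ln (real M)"
        using M0 K \<beta> by (intro divide_left_mono mult_pos_pos) auto
      then show ?thesis
        by simp
    qed
    ultimately show ?thesis
      by linarith
  qed
  moreover have "0 < ln 2 / K"
    using K by simp
  ultimately show ?thesis
    by blast
qed

theorem theorem1p2:
  shows "\<exists>c C :: real. 0 < c \<and> c < C \<and>
    (\<forall>\<beta> \<ge> 2. c / ln \<beta> \<le> distance_exponent TYPE('d::finite) \<beta> \<and>
              distance_exponent TYPE('d) \<beta> \<le> C / ln \<beta>)"
proof -
  obtain c where c: "c > 0" "\<And>\<beta>. \<beta> \<ge> 2 \<Longrightarrow> c / ln \<beta> \<le> distance_exponent TYPE('d) \<beta>"
    using distance_exponent_lower by blast
  obtain C where C: "C > 0" "\<And>\<beta>. \<beta> \<ge> 2 \<Longrightarrow> distance_exponent TYPE('d) \<beta> \<le> C / ln \<beta>"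
    using distance_exponent_upper by blast
  \<comment> \<open>Enlarging the upper constant to \<open>c + C\<close> secures the strict
    inequality between the two constants.\<close>
  have "distance_exponent TYPE('d) \<beta> \<le> (c + C) / ln \<beta>" if "\<beta> \<ge> 2" for \<beta>
  proof -
    have "C / ln \<beta> \<le> (c + C) / ln \<beta>"
      using c(1) that by (intro divide_right_mono) auto
    then show ?thesis
      using C(2)[OF that] by linarith
  qed
  then show ?thesis
    using c C(1) by (intro exI[of _ c] exI[of _ "c + C"]) auto
qed

end
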